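(* For every $\varepsilon>0$ and every $0<\beta<1$ there exist $n_0\in\mathbb{N}$ and a deterministic algorithm with polynomial running time which, given any $\beta$-bounded $n$-square with $n\geq n_0$, finds a transversal of size at least $(1-\beta/4-\varepsilon)n$ in it.
   Context: A $\beta$-bounded $n$-square is an $n\times n$ array filled with symbols such that no symbol appears more than $\beta n$ times in the array. A transversal in an array filled with symbols is a collection of entries of the array no two of which share a row, a column, or a symbol; its size is the number of entries. *)

theory Defs
  imports Complex_Main "HOL-Computational_Algebra.Polynomial"
begin

section \<open>Squares and transversals\<close>

text \<open>
  An \<open>n\<close>-square is a function \<open>A\<close>, of which only the entries \<open>A i j\<close> with
  \<open>i, j < n\<close> are relevant.
\<close>

definition bounded_square :: "real \<Rightarrow> nat \<Rightarrow> (nat \<Rightarrow> nat \<Rightarrow> 'a) \<Rightarrow> bool" where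
  "bounded_square \<beta> n A \<longleftrightarrow>
     (\<forall>x. real (card {(i, j). i < n \<and> j < n \<and> A i j = x}) \<le> \<beta> * real n)"

definition transversal :: "nat \<Rightarrow> (nat \<Rightarrow> nat \<Rightarrow> 'a) \<Rightarrow> (nat \<times> nat) set \<Rightarrow> bool" where
  "transversal n A T \<longleftrightarrow>
     T \<subseteq> {..<n} \<times> {..<n} \<and>
     (\<forall>(i, j)\<in>T. \<forall>(i', j')\<in>T. (i, j) \<noteq> (i', j') \<longrightarrow>
        i \<noteq> i' \<and> j \<noteq> j' \<and> A i j \<noteq> A i' j')"

section \<open>A deterministic model of computation\<close>

text \<open>
  Algorithms are programs of a structured random access machine: a while language whose
  variables are unbounded arrays of natural numbers (a scalar is an array used at index 0).
  Every evaluated node of an expression and every executed command costs one step. There is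
  no multiplication, so a step lengthens the largest number in memory by at most a constant
  number of bits (depending on the program); hence step counts are polynomially related to
  the running time of a deterministic Turing machine.
\<close>

type_synonym mem = "string \<Rightarrow> nat \<Rightarrow> nat"

datatype aexp =
    Const nat
  | Get string aexp
  | Plus aexp aexp
  | Minus aexp aexp

datatype bexp =
    Less aexp aexp
  | Neg bexp
  | Conj bexp bexp

datatype com =
    Skip
  | Put string aexp aexp
  | Seq com com
  | Cond bexp com com
  | While bexp com

fun aval :: "aexp \<Rightarrow> mem \<Rightarrow> nat" where
  "aval (Const c) s = c"
| "aval (Get x i) s = s x (aval i s)"
| "aval (Plus a b) s = aval a s + aval b s"
| "aval (Minus a b) s = aval a s - aval b s"

fun bval :: "bexp \<Rightarrow> mem \<Rightarrow> bool" where
  "bval (Less a b) s \<longleftrightarrow> aval a s < aval b s"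
| "bval (Neg b) s \<longleftrightarrow> \<not> bval b s"
| "bval (Conj b c) s \<longleftrightarrow> bval b s \<and> bval c s"

fun acost :: "aexp \<Rightarrow> nat" where
  "acost (Const c) = 1"
| "acost (Get x i) = 1 + acost i"
| "acost (Plus a b) = 1 + acost a + acost b"
| "acost (Minus a b) = 1 + acost a + acost b"

fun bcost :: "bexp \<Rightarrow> nat" where
  "bcost (Less a b) = 1 + acost a + acost b"
| "bcost (Neg b) = 1 + bcost b"
| "bcost (Conj b c) = 1 + bcost b + bcost c"

text \<open>
  \<open>exec c s t s'\<close>: started in memory \<open>s\<close>, the program \<open>c\<close> halts after \<open>t\<close> steps in
  memory \<open>s'\<close>.
\<close>

inductive exec :: "com \<Rightarrow> mem \<Rightarrow> nat \<Rightarrow> mem \<Rightarrow> bool" where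
  Skip: "exec Skip s 1 s"
| Put: "exec (Put x i a) s (1 + acost i + acost a) (s(x := (s x)(aval i s := aval a s)))"
| Seq: "exec c1 s1 t1 s2 \<Longrightarrow> exec c2 s2 t2 s3 \<Longrightarrow> exec (Seq c1 c2) s1 (1 + t1 + t2) s3"
| CondTrue: "bval b s \<Longrightarrow> exec c1 s t s' \<Longrightarrow> exec (Cond b c1 c2) s (1 + bcost b + t) s'"
| CondFalse: "\<not> bval b s \<Longrightarrow> exec c2 s t s' \<Longrightarrow> exec (Cond b c1 c2) s (1 + bcost b + t) s'"
| WhileFalse: "\<not> bval b s \<Longrightarrow> exec (While b c) s (1 + bcost b) s"
| WhileTrue: "bval b s1 \<Longrightarrow> exec c s1 t1 s2 \<Longrightarrow> exec (While b c) s2 t2 s3 \<Longrightarrow>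
    exec (While b c) s1 (1 + bcost b + t1 + t2) s3"

inductive_cases SkipE: "exec Skip s t s'"
inductive_cases PutE: "exec (Put x i a) s t s'"
inductive_cases SeqE: "exec (Seq c1 c2) s t s'"
inductive_cases CondE: "exec (Cond b c1 c2) s t s'"

lemma exec_deterministic:
  "exec c s t s' \<Longrightarrow> exec c s u s'' \<Longrightarrow> t = u \<and> s' = s''"
proof (induction arbitrary: u s'' rule: exec.induct)
  case (Skip s)
  then show ?case by (auto elim: SkipE)
next
  case (Put x i a s)
  then show ?case by (auto elim: PutE)
next
  case (Seq c1 s1 t1 s2 c2 t2 s3)
  from Seq.prems obtain v1 v2 r where
    r: "exec c1 s1 v1 r" "exec c2 r v2 s''" "u = 1 + v1 + v2"
    by (auto elim: SeqE)
  from Seq.IH(1)[OF r(1)] r Seq.IH(2)[of v2 s''] show ?case by simp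
next
  case (CondTrue b s c1 t s' c2)
  from CondTrue.prems CondTrue.hyps(1) obtain v where
    "exec c1 s v s''" "u = 1 + bcost b + v"
    by (auto elim: CondE)
  with CondTrue.IH[of v s''] show ?case by simp
next
  case (CondFalse b s c2 t s' c1)
  from CondFalse.prems CondFalse.hyps(1) obtain v where
    "exec c2 s v s''" "u = 1 + bcost b + v"
    by (auto elim: CondE)
  with CondFalse.IH[of v s''] show ?case by simp
next
  case (WhileFalse b s c)
  from WhileFalse.prems WhileFalse.hyps show ?case by cases auto
next
  case (WhileTrue b s1 c t1 s2 t2 s3)
  from WhileTrue.prems WhileTrue.hyps(1) obtain v1 v2 r where
    r: "exec c s1 v1 r" "exec (While b c) r v2 s''" "u = 1 + bcost b + v1 + v2"
    by cases auto
  from WhileTrue.IH(1)[OF r(1)] r WhileTrue.IH(2)[of v2 s''] show ?case by simp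
qed

section \<open>Algorithms on squares\<close>

text \<open>
  Symbols are presented to the machine as natural numbers, of arbitrary size. The square is
  stored row by row; all cells not occupied by the input are 0.
\<close>

definition input :: "nat \<Rightarrow> (nat \<Rightarrow> nat \<Rightarrow> nat) \<Rightarrow> mem" where
  "input n A x k =
     (if x = ''n'' \<and> k = 0 then n
      else if x = ''A'' \<and> k < n * n then A (k div n) (k mod n)
      else 0)"

definition result :: "mem \<Rightarrow> (nat \<times> nat) list" where
  "result s = map (\<lambda>k. (s ''row'' k, s ''col'' k)) [0..<s ''size'' 0]"

text \<open>
  The input occupies \<open>n\<^sup>2 + 1\<close> memory cells, so being polynomial in \<open>n\<close> is being polynomial
  in the size of the input. The bound is required on all squares, bounded or not.
\<close>

definition polynomial_time :: "com \<Rightarrow> bool" where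
  "polynomial_time c \<longleftrightarrow>
     (\<exists>p :: nat poly. \<forall>n A. \<exists>t s. exec c (input n A) t s \<and> t \<le> poly p n)"

text \<open>
  The resulting list must be free of repetitions, so that its length is the size of the
  transversal.
\<close>

definition finds_transversal :: "com \<Rightarrow> nat \<Rightarrow> (nat \<Rightarrow> nat \<Rightarrow> nat) \<Rightarrow> real \<Rightarrow> bool" where
  "finds_transversal c n A m \<longleftrightarrow>
     (\<exists>t s. exec c (input n A) t s \<and> distinct (result s) \<and>
        transversal n A (set (result s)) \<and> real (card (set (result s))) \<ge> m)"

end

theory Submission
  imports Defs
begin

text \<open>
  The algorithm is local search: as long as inserting a bounded number \<open>M\<close> of entries (and
  dropping the entries of \<open>T\<close> in conflict with them) enlarges the transversal \<open>T\<close>, do so.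

  Let \<open>T\<close> be a local optimum missing \<open>g\<close> rows and columns. Call an entry of \<open>T\<close> free if a
  bounded symbol-preserving swap uncovers its row and its column, and let \<open>E\<close> be a set of \<open>x\<close>
  free entries. If a row and a column, each uncovered or belonging to \<open>E\<close>, can be uncovered by
  disjoint swaps, then the symbol at their crossing must occur in \<open>T\<close>, by local optimality, and
  moving this symbol to the crossing shows that its entry in \<open>T\<close> is free as well. There are
  \<open>(g + x)\<^sup>2\<close> crossings and each symbol occurs at most \<open>\<beta> n\<close> times, so about
  \<open>(g + x)\<^sup>2 / (\<beta> n)\<close> entries are free. If \<open>g \<ge> (\<beta> / 4 + \<epsilon>) n\<close> this exceeds \<open>x\<close> by a constant
  fraction of \<open>n\<close>, which cannot be iterated more than a bounded number of times.

  To make the swaps disjoint, freeness is required robustly: for each bounded set \<open>F\<close> of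
  indices, all but boundedly many entries of \<open>E\<close> are freed by swaps avoiding \<open>F\<close>. This survives
  the iteration when only symbols with at least \<open>\<delta> n\<close> suitable occurrences are added, because
  the forbidden crossings are only \<open>O(n)\<close> in number and so spoil boundedly many such symbols.
\<close>

section \<open>Local optima\<close>

definition symb :: "(nat \<Rightarrow> nat \<Rightarrow> 'a) \<Rightarrow> nat \<times> nat \<Rightarrow> 'a" where
  "symb A e = A (fst e) (snd e)"

lemma transversal_iff:
  "transversal n A T \<longleftrightarrow>
     T \<subseteq> {..<n} \<times> {..<n} \<and> inj_on fst T \<and> inj_on snd T \<and> inj_on (symb A) T"
proof -
  have "(\<forall>(i, j)\<in>T. \<forall>(i', j')\<in>T. (i, j) \<noteq> (i', j') \<longrightarrow>
        i \<noteq> i' \<and> j \<noteq> j' \<and> A i j \<noteq> A i' j') \<longleftrightarrow>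
      (\<forall>x\<in>T. \<forall>y\<in>T. x \<noteq> y \<longrightarrow>
        fst x \<noteq> fst y \<and> snd x \<noteq> snd y \<and> symb A x \<noteq> symb A y)" (is "?L \<longleftrightarrow> ?R")
    by (simp only: symb_def case_prod_unfold prod.collapse)
  moreover have "?R \<longleftrightarrow> inj_on fst T \<and> inj_on snd T \<and> inj_on (symb A) T"
    unfolding inj_on_def by blast
  ultimately show ?thesis
    unfolding transversal_def by argo
qed

lemma transversalD:
  assumes "transversal n A T"
  shows "finite T" "inj_on fst T" "inj_on snd T" "inj_on (symb A) T"
    "fst ` T \<subseteq> {..<n}" "snd ` T \<subseteq> {..<n}" "card T \<le> n"
proof -
  show sub: "inj_on fst T" "inj_on snd T" "inj_on (symb A) T"
    "fst ` T \<subseteq> {..<n}" "snd ` T \<subseteq> {..<n}"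
    using assms unfolding transversal_iff by auto
  show "finite T"
    using assms unfolding transversal_iff by (meson finite_SigmaI finite_lessThan finite_subset)
  show "card T \<le> n"
    using card_inj_on_le[OF sub(1) sub(4)] by simp
qed

lemma transversal_insert:
  assumes U: "transversal n A U" and e: "e \<in> {..<n} \<times> {..<n}"
    "fst e \<notin> fst ` U" "snd e \<notin> snd ` U" "symb A e \<notin> symb A ` U"
  shows "transversal n A (insert e U)"
proof -
  have inj: "inj_on f (insert e U)" if "inj_on f U" "f e \<notin> f ` U" for f :: "nat \<times> nat \<Rightarrow> 'b"
    using that by (simp add: inj_on_insert) blast
  show ?thesis
    using U e unfolding transversal_iff by (intro conjI inj) simp_all
qed

lemma transversal_subset:
  "transversal n A U \<Longrightarrow> V \<subseteq> U \<Longrightarrow> transversal n A V"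
  unfolding transversal_iff by (meson inj_on_subset subset_trans)

section \<open>Numerical parameters of the iteration\<close>

text \<open>Multiplied by \<open>n\<close>, this bounds the crossings that no combined shift
  uncovers. The first two summands count whole bad rows. The rest counts bad columns per remaining
  row, where the second shift must also avoid that row and the at most \<open>4 * m\<close> indices
  met by the first.\<close>

definition loss :: "nat \<Rightarrow> (nat \<Rightarrow> nat) \<Rightarrow> nat \<Rightarrow> nat" where
  "loss m L K = L K + K + (L (K + 1 + 4 * m) + (K + 1 + 4 * m))"

text \<open>Merging two shifts doubles the budget, and one more entry is then exchanged.\<close>

primrec swap_size :: "nat \<Rightarrow> nat" where
  "swap_size 0 = 0"
| "swap_size (Suc i) = 2 * swap_size i + 1"

text \<open>The recursion adds up the exceptions inherited from the previous set, the entries of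
  \<open>T\<close> on a forbidden row or column, and the entries whose frequent symbol occurs at bad
  crossings only.\<close>

primrec exceptions :: "real \<Rightarrow> nat \<Rightarrow> nat \<Rightarrow> nat" where
  "exceptions \<delta> 0 = (\<lambda>K. 0)"
| "exceptions \<delta> (Suc i) = (\<lambda>K. exceptions \<delta> i K + 2 * K +
     nat \<lfloor>real (loss (swap_size i) (exceptions \<delta> i) K) / \<delta>\<rfloor>)"

lemma swap_size_mono: "i \<le> j \<Longrightarrow> swap_size i \<le> swap_size j"
  by (induction rule: dec_induct) auto

section \<open>Shifts of a fixed transversal and robust freeness\<close>

locale fixed_transversal =
  fixes n :: nat and A :: "nat \<Rightarrow> nat \<Rightarrow> 'a" and T :: "(nat \<times> nat) set"
  assumes T: "transversal n A T"
begin

text \<open>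
  Row and column indices are deliberately not distinguished: only the boundedness of the
  number of indices met by a change matters.
\<close>

definition supp :: "(nat \<times> nat) set \<Rightarrow> nat set" where
  "supp U = fst ` ((T - U) \<union> (U - T)) \<union> snd ` ((T - U) \<union> (U - T))"

text \<open>Equal symbol sets force equal sizes, so one further insertion after a shift would beat
  \<open>T\<close>. Confining removals to \<open>E\<close> guarantees that entries outside
  \<open>E\<close> are still in place afterwards.\<close>

definition shift :: "nat \<Rightarrow> (nat \<times> nat) set \<Rightarrow> nat set \<Rightarrow> (nat \<times> nat) set \<Rightarrow> bool" where
  "shift m E F U \<longleftrightarrow> transversal n A U \<and> symb A ` U = symb A ` T \<and> T - U \<subseteq> E \<and>
     card (U - T) \<le> m \<and> supp U \<inter> F = {}"

text \<open>\<open>F\<close> is fixed before the shifts are chosen, so it may contain the indices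
  met by an earlier shift; this is how disjoint shifts are obtained.\<close>

definition robust :: "nat \<Rightarrow> (nat \<Rightarrow> nat) \<Rightarrow> (nat \<times> nat) set \<Rightarrow> bool" where
  "robust m L E \<longleftrightarrow> E \<subseteq> T \<and> (\<forall>F K. finite F \<longrightarrow> card F \<le> K \<longrightarrow>
     card {e\<in>E. \<not> (\<exists>U. shift m E F U \<and> fst e \<notin> fst ` U \<and> snd e \<notin> snd ` U)} \<le> L K)"

text \<open>For \<open>E \<subseteq> T\<close> these are the rows missed by \<open>T\<close>
  together with the rows of \<open>E\<close>.\<close>

definition rows :: "(nat \<times> nat) set \<Rightarrow> nat set" where
  "rows E = {..<n} - fst ` (T - E)"

definition cols :: "(nat \<times> nat) set \<Rightarrow> nat set" where
  "cols E = {..<n} - snd ` (T - E)"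

text \<open>One and the same shift uncovers both lines, so that the crossing can be filled next. Its
  own indices avoid \<open>F\<close> because they would join the support of the enlarged
  change.\<close>

definition pair_free :: "nat \<Rightarrow> (nat \<times> nat) set \<Rightarrow> nat set \<Rightarrow> nat \<times> nat \<Rightarrow> bool" where
  "pair_free m E F e \<longleftrightarrow> fst e \<notin> F \<and> snd e \<notin> F \<and>
     (\<exists>U. shift m E F U \<and> fst e \<notin> fst ` U \<and> snd e \<notin> snd ` U)"

lemma card_symb:
  assumes "transversal n A U" "symb A ` U = symb A ` T"
  shows "card U = card T"
  using card_image[OF transversalD(4)[OF assms(1)]] card_image[OF transversalD(4)[OF T]] assms(2)
  by simp

lemma shift_id: "shift m E F T"
  using T by (simp add: shift_def supp_def)

text \<open>As \<open>U\<close> and \<open>T\<close> have equal size, as many entries leave as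
  arrive; the at most \<open>2 * m\<close> changed entries contribute two indices each.\<close>

lemma card_supp:
  assumes "shift m E F U"
  shows "finite (supp U)" "card (supp U) \<le> 4 * m"
proof -
  have U: "transversal n A U" "symb A ` U = symb A ` T" "card (U - T) \<le> m"
    using assms unfolding shift_def by auto
  note fin = transversalD(1)[OF U(1)] transversalD(1)[OF T]
  have "card (T - U) = card (U - T)"
    using card_symb[OF U(1,2)] fin by (simp add: card_Diff_subset_Int Int_commute)
  then have c: "card ((T - U) \<union> (U - T)) \<le> 2 * m"
    using card_Un_le[of "T - U" "U - T"] U(3) by simp
  show "finite (supp U)" unfolding supp_def using fin by auto
  have "card (supp U) \<le> card (fst ` ((T - U) \<union> (U - T))) + card (snd ` ((T - U) \<union> (U - T)))"
    unfolding supp_def by (rule card_Un_le)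
  also have "\<dots> \<le> card ((T - U) \<union> (U - T)) + card ((T - U) \<union> (U - T))"
    using fin by (intro add_mono card_image_le) auto
  finally show "card (supp U) \<le> 4 * m" using c by simp
qed

text \<open>The entry of \<open>T\<close> with the symbol of \<open>x\<close> cannot remain in
  \<open>U\<close>, where the symbol would then occur twice.\<close>

lemma shift_symbols:
  assumes "shift m E F U" "x \<in> U - T"
  obtains y where "y \<in> T - U" "symb A y = symb A x"
proof -
  have U: "transversal n A U" "symb A ` U = symb A ` T"
    using assms unfolding shift_def by auto
  have "symb A x \<in> symb A ` T" using U(2) assms(2) by auto
  then obtain y where y: "y \<in> T" "symb A y = symb A x" by auto
  have "y \<notin> U"
    using inj_onD[OF transversalD(4)[OF U(1)] y(2)] y(1) assms(2) by blast
  with y that show ?thesis by blast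
qed

text \<open>Changes with disjoint supports do not interact: keep what both keep and insert what
  either inserts. The row uncovered by the first stays uncovered since the second does not touch it,
  and symmetrically for the column.\<close>

lemma shift_combine:
  assumes 1: "shift m E F U1" and 2: "shift m E F U2"
    and disj: "supp U1 \<inter> supp U2 = {}"
    and r: "r \<notin> fst ` U1" "r \<notin> supp U2"
    and c: "c \<notin> snd ` U2" "c \<notin> supp U1"
  obtains U where "shift (2 * m) E F U" "r \<notin> fst ` U" "c \<notin> snd ` U"
proof -
  define U where "U = (U1 \<inter> U2) \<union> (U1 - T) \<union> (U2 - T)"
  note D1 = 1[unfolded shift_def] and D2 = 2[unfolded shift_def]
  note I1 = transversalD(1-4)[OF D1[THEN conjunct1]]
  note I2 = transversalD(1-4)[OF D2[THEN conjunct1]]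
  note I = transversalD(1-4)[OF T]
  \<comment> \<open>Equal symbols would be traced back to one entry of \<open>T\<close> dropped by
    both shifts, and its row would lie in both supports.\<close>
  have cross: "fst x \<noteq> fst y \<and> snd x \<noteq> snd y \<and> symb A x \<noteq> symb A y"
    if x: "x \<in> U1 - T" and y: "y \<in> U2 - T" for x y
  proof -
    have s: "fst x \<in> supp U1" "snd x \<in> supp U1" "fst y \<in> supp U2" "snd y \<in> supp U2"
      using x y unfolding supp_def by auto
    obtain x' where x': "x' \<in> T - U1" "symb A x' = symb A x"
      using shift_symbols[OF 1 x] .
    obtain y' where y': "y' \<in> T - U2" "symb A y' = symb A y"
      using shift_symbols[OF 2 y] .
    have "fst x' \<in> supp U1" "fst y' \<in> supp U2"
      using x' y' unfolding supp_def by auto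
    then have "x' \<noteq> y'" using disj by auto
    then have "symb A x \<noteq> symb A y"
      using I(4) x' y' unfolding inj_on_def by (metis DiffD1)
    with s disj show ?thesis by auto
  qed
  have inj: "inj_on f U"
    if "inj_on f U1" "inj_on f U2" "\<And>x y. x \<in> U1 - T \<Longrightarrow> y \<in> U2 - T \<Longrightarrow> f x \<noteq> f y"
    for f :: "nat \<times> nat \<Rightarrow> 'b"
  proof (rule inj_onI)
    fix x y assume xy: "x \<in> U" "y \<in> U" "f x = f y"
    \<comment> \<open>Only an entry new in \<open>U1\<close> against one new in \<open>U2\<close> is
      a genuinely mixed case; any other pair lies in a common transversal.\<close>
    then consider "x \<in> U1" "y \<in> U1" | "x \<in> U2" "y \<in> U2"
      | "x \<in> U1 - T" "y \<in> U2 - T" | "y \<in> U1 - T" "x \<in> U2 - T"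
      unfolding U_def by (elim UnE IntE) blast+
    then show "x = y"
    proof cases
      case 1 then show ?thesis using that(1) xy(3) by (meson inj_onD)
    next
      case 2 then show ?thesis using that(2) xy(3) by (meson inj_onD)
    next
      case 3 then show ?thesis using that(3) xy(3) by metis
    next
      case 4 then show ?thesis using that(3) xy(3) by metis
    qed
  qed
  have "transversal n A U"
    unfolding transversal_iff
  proof (intro conjI inj)
    show "U \<subseteq> {..<n} \<times> {..<n}"
      using D1 D2 unfolding U_def transversal_iff
      by (intro Un_least) (simp_all add: le_infI1 Diff_subset subset_trans[OF Diff_subset])
  qed (use I1 I2 cross in auto)
  moreover have "symb A ` U = symb A ` T"
  proof
    have "symb A ` U \<subseteq> symb A ` U1 \<union> symb A ` U2" unfolding U_def by auto
    then show "symb A ` U \<subseteq> symb A ` T" using D1 D2 by simp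
    show "symb A ` T \<subseteq> symb A ` U"
    proof
      fix v assume v: "v \<in> symb A ` T"
      then obtain t where t: "t \<in> T" "v = symb A t" by auto
      obtain u1 where u1: "u1 \<in> U1" "v = symb A u1" using v D1 by (metis imageE)
      obtain u2 where u2: "u2 \<in> U2" "v = symb A u2" using v D2 by (metis imageE)
      show "v \<in> symb A ` U"
      proof (cases "u1 \<in> T \<and> u2 \<in> T")
        case True
        then have "u1 = t" "u2 = t" using I(4) t u1 u2 by (metis inj_onD)+
        then show ?thesis using u1 u2 unfolding U_def by auto
      next
        case False
        then have "u1 \<in> U \<or> u2 \<in> U" using u1 u2 unfolding U_def by auto
        then show ?thesis using u1(2) u2(2) by blast
      qed
    qed
  qed
  moreover have "T - U \<subseteq> E"
  proof -
    have "T - U \<subseteq> (T - U1) \<union> (T - U2)" unfolding U_def by auto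
    then show ?thesis using D1 D2 by (meson Un_least subset_trans)
  qed
  moreover have "card (U - T) \<le> 2 * m"
  proof -
    have "card (U - T) \<le> card ((U1 - T) \<union> (U2 - T))"
      unfolding U_def using I1(1) I2(1) by (intro card_mono) auto
    also have "\<dots> \<le> card (U1 - T) + card (U2 - T)" by (rule card_Un_le)
    finally show ?thesis using D1 D2 by linarith
  qed
  moreover have "supp U \<inter> F = {}"
  proof -
    have "(T - U) \<union> (U - T) \<subseteq> ((T - U1) \<union> (U1 - T)) \<union> ((T - U2) \<union> (U2 - T))"
      unfolding U_def by blast
    then have "supp U \<subseteq> supp U1 \<union> supp U2" unfolding supp_def by blast
    moreover have "supp U1 \<inter> F = {}" "supp U2 \<inter> F = {}" using D1 D2 by simp_all
    ultimately show ?thesis by blast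
  qed
  ultimately have "shift (2 * m) E F U" unfolding shift_def by simp
  moreover have "r \<notin> fst ` U" using r unfolding U_def supp_def by auto
  moreover have "c \<notin> snd ` U" using c unfolding U_def supp_def by auto
  ultimately show ?thesis using that by blast
qed

section \<open>Counting crossings that cannot be uncovered\<close>

lemma card_rows_cols:
  assumes "E \<subseteq> T"
  shows "card (rows E) = n - card T + card E" "card (cols E) = n - card T + card E"
proof -
  have fin: "finite T" "finite E" "card E \<le> card T" "card T \<le> n"
    using transversalD[OF T] assms card_mono finite_subset by auto
  have d: "card (T - E) = card T - card E" using assms fin by (simp add: card_Diff_subset)
  have i: "card (fst ` (T - E)) = card (T - E)" "card (snd ` (T - E)) = card (T - E)"
    by (meson transversalD(2,3)[OF T] Diff_subset card_image inj_on_subset)+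
  have sub: "fst ` (T - E) \<subseteq> {..<n}" "snd ` (T - E) \<subseteq> {..<n}"
    using transversalD(5,6)[OF T] by auto
  have "card (rows E) = n - card (fst ` (T - E))"
    unfolding rows_def using sub fin by (subst card_Diff_subset) auto
  then show "card (rows E) = n - card T + card E" using d i fin by simp
  have "card (cols E) = n - card (snd ` (T - E))"
    unfolding cols_def using sub fin by (subst card_Diff_subset) auto
  then show "card (cols E) = n - card T + card E" using d i fin by simp
qed

lemma rows_cases:
  assumes "r \<in> rows E"
  shows "r \<notin> fst ` T \<or> (\<exists>e\<in>E. r = fst e)"
  using assms unfolding rows_def by auto

lemma cols_cases:
  assumes "c \<in> cols E"
  shows "c \<notin> snd ` T \<or> (\<exists>e\<in>E. c = snd e)"
  using assms unfolding cols_def by auto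

text \<open>\<open>T\<close> itself is a shift, so a line missed by \<open>T\<close> is never bad.
  Each bad line therefore passes through a bad entry of \<open>E\<close>.\<close>

lemma robust_lines:
  assumes R: "robust m L E" and F: "finite F" "card F \<le> K"
  shows "card {r \<in> rows E. \<not> (\<exists>U. shift m E F U \<and> r \<notin> fst ` U)} \<le> L K"
    and "card {c \<in> cols E. \<not> (\<exists>U. shift m E F U \<and> c \<notin> snd ` U)} \<le> L K"
proof -
  define B where
    "B = {e\<in>E. \<not> (\<exists>U. shift m E F U \<and> fst e \<notin> fst ` U \<and> snd e \<notin> snd ` U)}"
  have B: "card B \<le> L K" using R F unfolding robust_def B_def by blast
  have "finite E" using R transversalD(1)[OF T] finite_subset unfolding robust_def by blast
  then have finB: "finite B" unfolding B_def by simp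
  have "{r \<in> rows E. \<not> (\<exists>U. shift m E F U \<and> r \<notin> fst ` U)} \<subseteq> fst ` B"
  proof
    fix r assume r: "r \<in> {r \<in> rows E. \<not> (\<exists>U. shift m E F U \<and> r \<notin> fst ` U)}"
    then have no: "r \<in> fst ` U" if "shift m E F U" for U using that by blast
    obtain e where "e \<in> E" "r = fst e"
      using rows_cases[of r E] no[OF shift_id] r by blast
    then show "r \<in> fst ` B" unfolding B_def using no by blast
  qed
  then show "card {r \<in> rows E. \<not> (\<exists>U. shift m E F U \<and> r \<notin> fst ` U)} \<le> L K"
    using finB B by (meson card_image_le card_mono finite_imageI le_trans)
  have "{c \<in> cols E. \<not> (\<exists>U. shift m E F U \<and> c \<notin> snd ` U)} \<subseteq> snd ` B"
  proof
    fix c assume c: "c \<in> {c \<in> cols E. \<not> (\<exists>U. shift m E F U \<and> c \<notin> snd ` U)}"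
    then have no: "c \<in> snd ` U" if "shift m E F U" for U using that by blast
    obtain e where "e \<in> E" "c = snd e"
      using cols_cases[of c E] no[OF shift_id] c by blast
    then show "c \<in> snd ` B" unfolding B_def using no by blast
  qed
  then show "card {c \<in> cols E. \<not> (\<exists>U. shift m E F U \<and> c \<notin> snd ` U)} \<le> L K"
    using finB B by (meson card_image_le card_mono finite_imageI le_trans)
qed

text \<open>The shifts are chosen one after the other: first one for each good row, then, by
  robustness, column shifts disjoint from it. Each good row thus has boundedly many bad columns, and
  there are boundedly many bad rows.\<close>

lemma card_not_pair_free:
  assumes R: "robust m L E" and F: "finite F" "card F \<le> K"
  shows "card {e \<in> rows E \<times> cols E. \<not> pair_free (2 * m) E F e} \<le> loss m L K * n"
proof -
  define G where "G = {r \<in> rows E. r \<notin> F \<and> (\<exists>U. shift m E F U \<and> r \<notin> fst ` U)}"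
  have "\<forall>r\<in>G. \<exists>U. shift m E F U \<and> r \<notin> fst ` U" unfolding G_def by blast
  then obtain U1 where U1: "\<And>r. r \<in> G \<Longrightarrow> shift m E F (U1 r) \<and> r \<notin> fst ` U1 r"
    by metis
  \<comment> \<open>Forbidding \<open>r\<close> keeps the column shift from refilling row
    \<open>r\<close>; conversely, a column outside \<open>F' r\<close> is untouched by the row
    shift.\<close>
  define F' where "F' r = insert r (F \<union> supp (U1 r))" for r
  define BC where "BC r = {c \<in> cols E. \<not> (\<exists>U. shift m E (F' r) U \<and> c \<notin> snd ` U)} \<union> F' r" for r
  define BR where "BR = {r \<in> rows E. \<not> (\<exists>U. shift m E F U \<and> r \<notin> fst ` U)} \<union> F"
  have lines: "rows E \<subseteq> {..<n}" "cols E \<subseteq> {..<n}" unfolding rows_def cols_def by auto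
  have fin: "finite (rows E)" "finite (cols E)" using lines finite_subset by blast+
  have BR: "card BR \<le> L K + K" "finite BR"
  proof -
    have "card BR \<le> card {r \<in> rows E. \<not> (\<exists>U. shift m E F U \<and> r \<notin> fst ` U)} + card F"
      unfolding BR_def by (rule card_Un_le)
    then show "card BR \<le> L K + K" using robust_lines(1)[OF R F] F by linarith
    show "finite BR" unfolding BR_def using F fin by simp
  qed
  have BC: "card (BC r) \<le> L (K + 1 + 4 * m) + (K + 1 + 4 * m)" "finite (BC r)" if "r \<in> G" for r
  proof -
    have s: "finite (supp (U1 r))" "card (supp (U1 r)) \<le> 4 * m"
      using card_supp U1[OF that] by blast+
    have fF: "finite (F' r)" unfolding F'_def using F s by simp
    have "card (F' r) \<le> Suc (card (F \<union> supp (U1 r)))" unfolding F'_def by (rule card_insert_le_m1) auto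
    also have "card (F \<union> supp (U1 r)) \<le> card F + card (supp (U1 r))" by (rule card_Un_le)
    finally have cF: "card (F' r) \<le> K + 1 + 4 * m" using s F by simp
    have "card (BC r) \<le> card {c \<in> cols E. \<not> (\<exists>U. shift m E (F' r) U \<and> c \<notin> snd ` U)} + card (F' r)"
      unfolding BC_def by (rule card_Un_le)
    then show "card (BC r) \<le> L (K + 1 + 4 * m) + (K + 1 + 4 * m)"
      using robust_lines(2)[OF R fF cF] cF by linarith
    show "finite (BC r)" unfolding BC_def using fF fin by simp
  qed
  have sub: "{e \<in> rows E \<times> cols E. \<not> pair_free (2 * m) E F e} \<subseteq> (BR \<times> {..<n}) \<union> (SIGMA r:G. BC r)"
  proof
    fix e assume e: "e \<in> {e \<in> rows E \<times> cols E. \<not> pair_free (2 * m) E F e}"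
    obtain r c where rc: "e = (r, c)" by (cases e)
    have rc': "r \<in> rows E" "c \<in> cols E" "c < n" using e rc lines by auto
    show "e \<in> (BR \<times> {..<n}) \<union> (SIGMA r:G. BC r)"
    proof (rule ccontr)
      assume not: "e \<notin> (BR \<times> {..<n}) \<union> (SIGMA r:G. BC r)"
      then have "r \<notin> BR" using rc rc' by auto
      then have rG: "r \<in> G" "r \<notin> F" using rc' unfolding BR_def G_def by auto
      then have "c \<notin> BC r" using not rc by auto
      then obtain U2 where U2: "shift m E (F' r) U2" "c \<notin> snd ` U2" and c: "c \<notin> F' r"
        using rc' unfolding BC_def by auto
      have s2: "supp U2 \<inter> F' r = {}" using U2 unfolding shift_def by simp
      then have "shift m E F U2" using U2 unfolding shift_def F'_def by auto
      then obtain U where "shift (2 * m) E F U" "r \<notin> fst ` U" "c \<notin> snd ` U"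
        using shift_combine[of m E F "U1 r" U2 r c] U1[OF rG(1)] U2(2) s2 c
        unfolding F'_def by blast
      then have "pair_free (2 * m) E F e"
        unfolding pair_free_def using rc rG c unfolding F'_def by auto
      then show False using e by simp
    qed
  qed
  have finG: "finite G" unfolding G_def using fin by simp
  have cG: "card G \<le> n"
    using card_mono[of "{..<n}" G] lines unfolding G_def by auto
  have "card {e \<in> rows E \<times> cols E. \<not> pair_free (2 * m) E F e} \<le> card ((BR \<times> {..<n}) \<union> (SIGMA r:G. BC r))"
    using sub BR(2) BC(2) finG by (intro card_mono) auto
  also have "\<dots> \<le> card (BR \<times> {..<n}) + card (SIGMA r:G. BC r)" by (rule card_Un_le)
  also have "card (BR \<times> {..<n}) = card BR * n" by (simp add: card_cartesian_product)
  also have "card (SIGMA r:G. BC r) = (\<Sum>r\<in>G. card (BC r))" using finG BC(2) by (simp add: card_SigmaI)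
  also have "\<dots> \<le> card G * (L (K + 1 + 4 * m) + (K + 1 + 4 * m))"
    using sum_bounded_above[OF BC(1), of G "\<lambda>r. r"] unfolding of_nat_id .
  also have "\<dots> \<le> n * (L (K + 1 + 4 * m) + (K + 1 + 4 * m))" using cG by (rule mult_le_mono1)
  also have "card BR * n \<le> (L K + K) * n" using BR(1) by (rule mult_le_mono1)
  finally show ?thesis unfolding loss_def by (simp add: algebra_simps)
qed

section \<open>Consequences of local optimality\<close>

definition locally_optimal :: "nat \<Rightarrow> bool" where
  "locally_optimal M \<longleftrightarrow> (\<forall>U. transversal n A U \<longrightarrow> card (U - T) \<le> M \<longrightarrow> card U \<le> card T)"

text \<open>Otherwise the crossing could be filled after the shift, giving a larger transversal with
  at most \<open>m + 1\<close> entries outside \<open>T\<close>.\<close>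

lemma pair_free_symbol:
  assumes opt: "locally_optimal (m + 1)" and e: "e \<in> rows E \<times> cols E"
    and free: "pair_free m E F e"
  shows "symb A e \<in> symb A ` T"
proof (rule ccontr)
  assume s: "symb A e \<notin> symb A ` T"
  obtain U where U: "shift m E F U" "fst e \<notin> fst ` U" "snd e \<notin> snd ` U"
    using free unfolding pair_free_def by blast
  note D = U(1)[unfolded shift_def]
  have tr: "transversal n A U" and sy: "symb A ` U = symb A ` T" and c: "card (U - T) \<le> m"
    using D by auto
  have "transversal n A (insert e U)"
  proof (rule transversal_insert[OF tr])
    show "e \<in> {..<n} \<times> {..<n}" using e unfolding rows_def cols_def by auto
    show "symb A e \<notin> symb A ` U" using s sy by simp
  qed (use U in auto)
  moreover have "card (insert e U - T) \<le> m + 1"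
  proof -
    have "card (insert e U - T) \<le> card (insert e (U - T))"
      using transversalD(1)[OF tr] by (intro card_mono) auto
    also have "\<dots> \<le> Suc (card (U - T))" by (rule card_insert_le_m1) auto
    finally show ?thesis using c by simp
  qed
  ultimately have "card (insert e U) \<le> card T" using opt unfolding locally_optimal_def by blast
  moreover have "card (insert e U) = Suc (card T)"
    using transversalD(1)[OF tr] U(2) card_symb[OF tr sy] by (subst card_insert_disjoint) auto
  ultimately show False by simp
qed

section \<open>Enlarging the set of free entries\<close>

definition occ :: "(nat \<times> nat) set \<Rightarrow> 'a \<Rightarrow> (nat \<times> nat) set" where
  "occ E x = {e \<in> rows E \<times> cols E. symb A e = x}"

definition extend :: "real \<Rightarrow> (nat \<times> nat) set \<Rightarrow> (nat \<times> nat) set" where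
  "extend \<delta> E = E \<union> {e\<in>T. \<delta> * n \<le> card (occ E (symb A e))}"

lemma extend_subset: "E \<subseteq> T \<Longrightarrow> extend \<delta> E \<subseteq> T"
  unfolding extend_def by auto

lemma finite_occ: "finite (occ E x)"
  unfolding occ_def rows_def cols_def by auto

lemma card_UN_occ:
  assumes "S \<subseteq> T"
  shows "card (\<Union>e\<in>S. occ E (symb A e)) = (\<Sum>e\<in>S. card (occ E (symb A e)))"
proof (rule card_UN_disjoint)
  show "finite S" using assms transversalD(1)[OF T] finite_subset by blast
  show "\<forall>e\<in>S. finite (occ E (symb A e))" using finite_occ by blast
  show "\<forall>e\<in>S. \<forall>e'\<in>S. e \<noteq> e' \<longrightarrow> occ E (symb A e) \<inter> occ E (symb A e') = {}"
  proof (intro ballI impI)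
    fix e e' assume "e \<in> S" "e' \<in> S" "e \<noteq> e'"
    then have "symb A e \<noteq> symb A e'"
      using inj_onD[OF transversalD(4)[OF T], of e e'] assms by blast
    then show "occ E (symb A e) \<inter> occ E (symb A e') = {}" unfolding occ_def by auto
  qed
qed

text \<open>Once the crossing \<open>x\<close> is uncovered, \<open>e\<close> is exchanged for
  \<open>x\<close>, which carries the same symbol. This uncovers both lines of \<open>e\<close> at
  the price of one more insertion.\<close>

lemma shift_replace:
  assumes U: "shift m E F U" "fst x \<notin> fst ` U" "snd x \<notin> snd ` U"
    and x: "x \<in> {..<n} \<times> {..<n}" "symb A x = symb A e" "fst x \<notin> F" "snd x \<notin> F"
    and e: "e \<in> T" "e \<notin> E" "fst e \<notin> F" "snd e \<notin> F"
    and E': "E \<subseteq> E'" "e \<in> E'"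
  obtains V where "shift (m + 1) E' F V" "fst e \<notin> fst ` V" "snd e \<notin> snd ` V"
proof -
  have D: "transversal n A U" "symb A ` U = symb A ` T" "T - U \<subseteq> E"
      "card (U - T) \<le> m" "supp U \<inter> F = {}"
    using U(1) unfolding shift_def by auto
  note I = transversalD(1-4)[OF D(1)]
  \<comment> \<open>A shift only removes entries of \<open>E\<close>, so \<open>e\<close> is still in place and can be exchanged.\<close>
  have eU: "e \<in> U" using D(3) e by blast
  define V where "V = insert x (U - {e})"
  have nx: "fst x \<noteq> fst e" "snd x \<noteq> snd e" using U(2,3) eU by auto
  have other: "f e \<notin> f ` (U - {e})" if "inj_on f U" for f :: "nat \<times> nat \<Rightarrow> 'b"
    using inj_on_image_mem_iff[OF that eU, of "U - {e}"] by auto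
  have e1: "fst e \<notin> fst ` V" using other[OF I(2)] nx unfolding V_def by auto
  have e2: "snd e \<notin> snd ` V" using other[OF I(3)] nx unfolding V_def by auto
  have sx: "symb A x \<notin> symb A ` (U - {e})" using other[OF I(4)] x(2) by simp
  have "transversal n A V"
    unfolding V_def
  proof (rule transversal_insert[OF transversal_subset[OF D(1)]])
    show "fst x \<notin> fst ` (U - {e})" "snd x \<notin> snd ` (U - {e})" using U(2,3) by blast+
  qed (use x sx in auto)
  moreover have "symb A ` V = symb A ` U"
  proof -
    have "symb A ` V = symb A ` insert e (U - {e})" unfolding V_def by (simp only: image_insert x(2))
    then show ?thesis using eU by (simp add: insert_absorb)
  qed
  moreover have "T - V \<subseteq> E'" using D(3) E' unfolding V_def by blast
  moreover have "card (V - T) \<le> m + 1"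
  proof -
    have "card (V - T) \<le> card (insert x (U - T))"
      unfolding V_def using I(1) by (intro card_mono) auto
    also have "\<dots> \<le> Suc (card (U - T))" by (rule card_insert_le_m1) auto
    finally show ?thesis using D(4) by simp
  qed
  moreover have "supp V \<inter> F = {}"
  proof -
    have "(T - V) \<union> (V - T) \<subseteq> ((T - U) \<union> (U - T)) \<union> {e, x}"
      unfolding V_def by auto
    then have "supp V \<subseteq> supp U \<union> {fst e, snd e, fst x, snd x}" unfolding supp_def by blast
    then show ?thesis using D(5) x e by blast
  qed
  ultimately have "shift (m + 1) E' F V" using D(2) unfolding shift_def by simp
  then show ?thesis using that e1 e2 by blast
qed

text \<open>An entry resists only if it was exceptional before, lies on a forbidden line, or has all
  occurrences of its frequent symbol at bad crossings. These classes \<open>B1\<close>,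
  \<open>B2\<close>, \<open>B3\<close> give the three summands; every other new entry is freed
  through \<open>shift_replace\<close>.\<close>

lemma robust_extend:
  assumes R: "robust m L E" and \<delta>: "0 < \<delta>" and n: "0 < n"
  shows "robust (2 * m + 1) (\<lambda>K. L K + 2 * K + nat \<lfloor>real (loss m L K) / \<delta>\<rfloor>) (extend \<delta> E)"
  unfolding robust_def
proof (intro conjI allI impI)
  have ET: "E \<subseteq> T" using R unfolding robust_def by blast
  show "extend \<delta> E \<subseteq> T" using ET by (rule extend_subset)
  note fT = transversalD(1)[OF T]
  fix F :: "nat set" and K assume F: "finite F" "card F \<le> K"
  define B1 where
    "B1 = {e\<in>E. \<not> (\<exists>U. shift m E F U \<and> fst e \<notin> fst ` U \<and> snd e \<notin> snd ` U)}"
  define B2 where "B2 = {e\<in>T. fst e \<in> F} \<union> {e\<in>T. snd e \<in> F}"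
  define B3 where "B3 = {e\<in>T. \<delta> * n \<le> card (occ E (symb A e)) \<and>
    (\<forall>x\<in>occ E (symb A e). \<not> pair_free (2 * m) E F x)}"
  let ?B = "{e\<in>extend \<delta> E. \<not> (\<exists>U. shift (2 * m + 1) (extend \<delta> E) F U \<and>
    fst e \<notin> fst ` U \<and> snd e \<notin> snd ` U)}"
  have fin: "finite B1" "finite B2" "finite B3"
    using fT finite_subset[OF ET fT] unfolding B1_def B2_def B3_def by simp_all
  have b1: "card B1 \<le> L K" using R F unfolding robust_def B1_def by blast
  have b2: "card B2 \<le> 2 * K"
  proof -
    have "card {e\<in>T. fst e \<in> F} \<le> card F"
      by (rule card_inj_on_le[where f = fst])
        (use F inj_on_subset[OF transversalD(2)[OF T]] in auto)
    moreover have "card {e\<in>T. snd e \<in> F} \<le> card F"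
      by (rule card_inj_on_le[where f = snd])
        (use F inj_on_subset[OF transversalD(3)[OF T]] in auto)
    moreover have "card B2 \<le> card {e\<in>T. fst e \<in> F} + card {e\<in>T. snd e \<in> F}"
      unfolding B2_def by (rule card_Un_le)
    ultimately show ?thesis using F(2) by linarith
  qed
  have b3: "card B3 \<le> nat \<lfloor>real (loss m L K) / \<delta>\<rfloor>"
  proof -
    \<comment> \<open>Each entry of \<open>B3\<close> accounts for at least
      \<open>\<delta> * n\<close> bad crossings of its own, and there are at most
      \<open>loss m L K * n\<close> bad crossings.\<close>
    have "real (card B3) * (\<delta> * n) \<le> (\<Sum>e\<in>B3. real (card (occ E (symb A e))))"
      by (rule sum_bounded_below) (simp add: B3_def)
    also have "\<dots> = real (card (\<Union>e\<in>B3. occ E (symb A e)))"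
      by (subst card_UN_occ) (auto simp: B3_def)
    also have "\<dots> \<le> real (card {e \<in> rows E \<times> cols E. \<not> pair_free (2 * m) E F e})"
    proof (intro of_nat_mono card_mono)
      show "finite {e \<in> rows E \<times> cols E. \<not> pair_free (2 * m) E F e}"
        unfolding rows_def cols_def by auto
      show "(\<Union>e\<in>B3. occ E (symb A e)) \<subseteq> {e \<in> rows E \<times> cols E. \<not> pair_free (2 * m) E F e}"
        unfolding B3_def occ_def by blast
    qed
    also have "\<dots> \<le> real (loss m L K * n)"
      using card_not_pair_free[OF R F] by (rule of_nat_mono)
    finally have "(real (card B3) * \<delta>) * n \<le> real (loss m L K) * n" by (simp add: mult.assoc)
    then have "real (card B3) * \<delta> \<le> real (loss m L K)" using n by simp
    then have "real (card B3) \<le> real (loss m L K) / \<delta>" using \<delta> by (simp add: pos_le_divide_eq)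
    then show ?thesis by (rule le_nat_floor)
  qed
  have "?B \<subseteq> B1 \<union> B2 \<union> B3"
  proof
    fix e assume e: "e \<in> ?B"
    then have no: "\<not> (shift (2 * m + 1) (extend \<delta> E) F U \<and> fst e \<notin> fst ` U \<and> snd e \<notin> snd ` U)" for U
      by blast
    have eT: "e \<in> T" using e extend_subset[OF ET] by blast
    show "e \<in> B1 \<union> B2 \<union> B3"
    proof (rule ccontr)
      assume n: "e \<notin> B1 \<union> B2 \<union> B3"
      show False
      proof (cases "e \<in> E")
        case True
        then obtain U where U: "shift m E F U" "fst e \<notin> fst ` U" "snd e \<notin> snd ` U"
          using n unfolding B1_def by blast
        then have "shift (2 * m + 1) (extend \<delta> E) F U" unfolding shift_def extend_def by auto
        then show False using no U by blast
      next
        case False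
        then have big: "\<delta> * n \<le> card (occ E (symb A e))" using e unfolding extend_def by blast
        then obtain x where x: "x \<in> occ E (symb A e)" "pair_free (2 * m) E F x"
          using n eT unfolding B3_def by blast
        obtain U where U: "shift (2 * m) E F U" "fst x \<notin> fst ` U" "snd x \<notin> snd ` U"
          and xF: "fst x \<notin> F" "snd x \<notin> F"
          using x(2) unfolding pair_free_def by blast
        have xn: "x \<in> {..<n} \<times> {..<n}" "symb A x = symb A e"
          using x(1) unfolding occ_def rows_def cols_def by auto
        have eF: "fst e \<notin> F" "snd e \<notin> F" using n eT unfolding B2_def by auto
        obtain V where "shift (2 * m + 1) (extend \<delta> E) F V" "fst e \<notin> fst ` V" "snd e \<notin> snd ` V"
          by (rule shift_replace[OF U xn xF eT False eF, of "extend \<delta> E"])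
            (use e in \<open>auto simp: extend_def\<close>)
        then show False using no by blast
      qed
    qed
  qed
  then have "card ?B \<le> card (B1 \<union> B2 \<union> B3)" using fin by (intro card_mono) auto
  also have "\<dots> \<le> card (B1 \<union> B2) + card B3" by (rule card_Un_le)
  also have "card (B1 \<union> B2) \<le> card B1 + card B2" by (rule card_Un_le)
  finally show "card ?B \<le> L K + 2 * K + nat \<lfloor>real (loss m L K) / \<delta>\<rfloor>"
    using b1 b2 b3 by linarith
qed

text \<open>The left side counts all crossings. At most \<open>loss m L 0 * n\<close> of them are
  bad; any other shows a symbol of \<open>T\<close>, which occurs at most \<open>\<beta> * n\<close>
  times if its entry is in \<open>extend \<delta> E\<close> and fewer than
  \<open>\<delta> * n\<close> times otherwise.\<close>

lemma card_extend:
  fixes \<beta> \<delta> :: real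
  assumes R: "robust m L E" and opt: "locally_optimal (2 * m + 1)"
    and \<beta>: "bounded_square \<beta> n A" and \<delta>: "0 \<le> \<delta>"
  shows "(real n - card T + card E)\<^sup>2 \<le> card (extend \<delta> E) * (\<beta> * n) + \<delta> * n * n + real (loss m L 0) * n"
proof -
  have ET: "E \<subseteq> T" using R unfolding robust_def by blast
  note sub = extend_subset[OF ET, of \<delta>]
  note fT = transversalD(1)[OF T]
  define B where "B = {e \<in> rows E \<times> cols E. \<not> pair_free (2 * m) E {} e}"
  have B: "card B \<le> loss m L 0 * n"
    unfolding B_def by (rule card_not_pair_free[OF R]) auto
  have le: "card (occ E y) \<le> \<beta> * n" for y
  proof -
    have "card (occ E y) \<le> card {(i, j). i < n \<and> j < n \<and> A i j = y}"
    proof (rule card_mono)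
      have "{(i, j). i < n \<and> j < n \<and> A i j = y} \<subseteq> {..<n} \<times> {..<n}" by auto
      then show "finite {(i, j). i < n \<and> j < n \<and> A i j = y}" by (rule finite_subset) auto
      show "occ E y \<subseteq> {(i, j). i < n \<and> j < n \<and> A i j = y}"
        unfolding occ_def rows_def cols_def symb_def by auto
    qed
    then show ?thesis using \<beta> unfolding bounded_square_def by (meson of_nat_mono order_trans)
  qed
  have "rows E \<times> cols E \<subseteq> B \<union> (\<Union>e\<in>T. occ E (symb A e))"
  proof
    fix x assume x: "x \<in> rows E \<times> cols E"
    show "x \<in> B \<union> (\<Union>e\<in>T. occ E (symb A e))"
    proof (cases "pair_free (2 * m) E {} x")
      case True
      from pair_free_symbol[OF opt x this] obtain e where "e \<in> T" "symb A x = symb A e" by blast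
      then show ?thesis using x unfolding occ_def by auto
    next
      case False
      then show ?thesis using x unfolding B_def by simp
    qed
  qed
  moreover have "finite (B \<union> (\<Union>e\<in>T. occ E (symb A e)))"
    using fT finite_occ unfolding B_def rows_def cols_def by auto
  ultimately have "card (rows E \<times> cols E) \<le> card (B \<union> (\<Union>e\<in>T. occ E (symb A e)))"
    by (intro card_mono)
  also have "\<dots> \<le> card B + card (\<Union>e\<in>T. occ E (symb A e))" by (rule card_Un_le)
  also have "card (\<Union>e\<in>T. occ E (symb A e)) = (\<Sum>e\<in>T. card (occ E (symb A e)))"
    by (rule card_UN_occ) simp
  finally have "real (card (rows E \<times> cols E)) \<le> card B + (\<Sum>e\<in>T. real (card (occ E (symb A e))))"
    by (metis of_nat_add of_nat_le_iff of_nat_sum)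
  also have "(\<Sum>e\<in>T. real (card (occ E (symb A e)))) =
      (\<Sum>e\<in>T - extend \<delta> E. real (card (occ E (symb A e)))) + (\<Sum>e\<in>extend \<delta> E. real (card (occ E (symb A e))))"
    using sub fT by (rule sum.subset_diff)
  also have "(\<Sum>e\<in>extend \<delta> E. real (card (occ E (symb A e)))) \<le> card (extend \<delta> E) * (\<beta> * n)"
    by (rule sum_bounded_above) (rule le)
  also have "(\<Sum>e\<in>T - extend \<delta> E. real (card (occ E (symb A e)))) \<le> card (T - extend \<delta> E) * (\<delta> * n)"
    by (rule sum_bounded_above) (auto simp: extend_def)
  also have "card (T - extend \<delta> E) * (\<delta> * n) \<le> n * (\<delta> * n)"
  proof (rule mult_right_mono)
    show "real (card (T - extend \<delta> E)) \<le> n"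
      using card_mono[OF fT, of "T - extend \<delta> E"] transversalD(7)[OF T] by auto
  qed (use \<delta> in simp)
  also have "real (card B) \<le> real (loss m L 0) * n" using of_nat_mono[OF B] by simp
  also have "real (card (rows E \<times> cols E)) = (real n - card T + card E)\<^sup>2"
  proof -
    have "real (n - card T + card E) = real n - card T + card E"
      using transversalD(7)[OF T] by simp
    then show ?thesis
      by (simp only: card_cartesian_product card_rows_cols[OF ET] of_nat_mult power2_eq_square)
  qed
  finally show ?thesis by (simp add: algebra_simps)
qed

section \<open>Iterating the extension at a local optimum\<close>

text \<open>
  With \<open>g = n - card T\<close> and \<open>x = card E\<close>, the quadratic \<open>(g + x)\<^sup>2 - \<beta> n x\<close> is positive for
  all \<open>x\<close> precisely when \<open>g > \<beta> n / 4\<close>; this is the origin of the constant \<open>1/4\<close>.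
\<close>

lemma robust_sequence:
  fixes \<epsilon> \<beta> :: real
  assumes \<epsilon>: "0 < \<epsilon>" and \<beta>: "0 < \<beta>" "\<beta> < 1" and n: "0 < n"
    and sq: "bounded_square \<beta> n A" and opt: "locally_optimal (swap_size k)"
    and small: "card T < (1 - \<beta> / 4 - \<epsilon>) * n"
    and loss: "\<And>i. i < k \<Longrightarrow> loss (swap_size i) (exceptions (\<epsilon>\<^sup>2 / 4) i) 0 \<le> \<epsilon>\<^sup>2 / 4 * n"
    and i: "i \<le> k"
  shows "\<exists>E. robust (swap_size i) (exceptions (\<epsilon>\<^sup>2 / 4) i) E \<and> i * (\<epsilon>\<^sup>2 / 2) * n \<le> card E"
  using i
proof (induction i)
  case 0
  show ?case by (intro exI[of _ "{}"]) (simp add: robust_def)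
next
  case (Suc i)
  \<comment> \<open>Both error terms of \<open>card_extend\<close> are at most
    \<open>\<delta> * n * n\<close>; together they use up only half of the surplus
    \<open>(\<epsilon> * n)\<^sup>2\<close>.\<close>
  define \<delta> where "\<delta> = \<epsilon>\<^sup>2 / 4"
  have \<delta>: "0 < \<delta>" using \<epsilon> unfolding \<delta>_def by simp
  obtain E where E: "robust (swap_size i) (exceptions \<delta> i) E" "i * (\<epsilon>\<^sup>2 / 2) * n \<le> card E"
    using Suc unfolding \<delta>_def by auto
  define x where "x = real (card E)"
  define x' where "x' = real (card (extend \<delta> E))"
  have opt': "locally_optimal (2 * swap_size i + 1)"
    using opt swap_size_mono[OF Suc.prems] unfolding locally_optimal_def
    by (metis order_trans swap_size.simps(2))
  have "(real n - card T + x)\<^sup>2 \<le> x' * (\<beta> * n) + \<delta> * n * n + real (loss (swap_size i) (exceptions \<delta> i) 0) * n"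
    using card_extend[OF E(1) opt' sq] \<delta> unfolding x_def x'_def by simp
  also have "real (loss (swap_size i) (exceptions \<delta> i) 0) * n \<le> \<delta> * n * n"
    using loss[of i] Suc.prems n unfolding \<delta>_def by (intro mult_right_mono) auto
  finally have upper: "(real n - card T + x)\<^sup>2 \<le> x' * (\<beta> * n) + \<epsilon>\<^sup>2 / 2 * n * n"
    unfolding \<delta>_def by (simp add: algebra_simps)
  have g: "(\<beta> / 4 + \<epsilon>) * n + x \<le> real n - card T + x" using small by (simp add: algebra_simps)
  have x0: "0 \<le> x" unfolding x_def by simp
  \<comment> \<open>The square \<open>(\<beta> / 4 * n + x)\<^sup>2\<close> exceeds
    \<open>\<beta> * n * x\<close> by exactly \<open>(\<beta> / 4 * n - x)\<^sup>2\<close>.\<close>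
  have "\<beta> * n * x + (\<epsilon> * n)\<^sup>2 \<le> (\<beta> / 4 * n + x)\<^sup>2 + (\<epsilon> * n)\<^sup>2"
    using zero_le_power2[of "\<beta> / 4 * n - x"] by (simp add: power2_eq_square algebra_simps)
  also have "\<dots> \<le> (\<beta> / 4 * n + x + \<epsilon> * n)\<^sup>2"
    using \<beta> \<epsilon> x0 by (simp add: power2_sum)
  also have "\<dots> = ((\<beta> / 4 + \<epsilon>) * n + x)\<^sup>2" by (simp add: algebra_simps)
  also have "\<dots> \<le> (real n - card T + x)\<^sup>2"
    using g \<beta> \<epsilon> x0 by (intro power_mono) auto
  also note upper
  finally have "\<beta> * n * x + \<epsilon>\<^sup>2 / 2 * n * n \<le> x' * (\<beta> * n)"
    by (simp add: power2_eq_square algebra_simps)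
  then have "(\<epsilon>\<^sup>2 / 2 * n) * n \<le> (\<beta> * (x' - x)) * n" by (simp add: algebra_simps)
  then have d: "\<epsilon>\<^sup>2 / 2 * n \<le> \<beta> * (x' - x)"
    by (rule mult_right_le_imp_le) (use n in simp)
  have "0 \<le> \<epsilon>\<^sup>2 / 2 * n" by simp
  with d have "0 \<le> \<beta> * (x' - x)" by linarith
  then have "0 \<le> x' - x" using \<beta> by (simp add: zero_le_mult_iff)
  then have "\<beta> * (x' - x) \<le> 1 * (x' - x)" using \<beta> by (intro mult_right_mono) auto
  then have "Suc i * (\<epsilon>\<^sup>2 / 2) * n \<le> x'"
    using d E(2) unfolding x_def by (simp add: algebra_simps)
  moreover have "robust (swap_size (Suc i)) (exceptions \<delta> (Suc i)) (extend \<delta> E)"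
    using robust_extend[OF E(1) \<delta> n] by simp
  ultimately show ?case unfolding x'_def \<delta>_def by blast
qed

end

text \<open>The lower bound on the number of free entries grows by
  \<open>\<epsilon>\<^sup>2 / 2 * n\<close> per round. Beyond \<open>2 / \<epsilon>\<^sup>2\<close>
  rounds it exceeds \<open>n\<close>, although all these entries lie in \<open>T\<close>.\<close>

lemma local_optimum_large:
  fixes \<epsilon> \<beta> :: real
  assumes "0 < \<epsilon>" "0 < \<beta>" "\<beta> < 1"
  shows "\<exists>M n0. \<forall>n (A :: nat \<Rightarrow> nat \<Rightarrow> 'a) T. n0 \<le> n \<longrightarrow> bounded_square \<beta> n A \<longrightarrow> transversal n A T \<longrightarrow>
    (\<forall>U. transversal n A U \<longrightarrow> card (U - T) \<le> M \<longrightarrow> card U \<le> card T) \<longrightarrow>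
    (1 - \<beta> / 4 - \<epsilon>) * n \<le> card T"
proof -
  define k where "k = nat \<lceil>2 / \<epsilon>\<^sup>2\<rceil> + 1"
  define l where "l = (\<lambda>i. real (loss (swap_size i) (exceptions (\<epsilon>\<^sup>2 / 4) i) 0))"
  \<comment> \<open>The sum dominates each of the finitely many losses, so each is at most
    \<open>\<epsilon>\<^sup>2 / 4 * n\<close>; adding 1 makes \<open>n\<close> positive.\<close>
  define n0 where "n0 = nat \<lceil>(\<Sum>i<k. l i) / (\<epsilon>\<^sup>2 / 4)\<rceil> + 1"
  have "(1 - \<beta> / 4 - \<epsilon>) * n \<le> card T"
    if n: "n0 \<le> n" and sq: "bounded_square \<beta> n A" and T: "transversal n A T"
      and opt: "\<forall>U. transversal n A U \<longrightarrow> card (U - T) \<le> swap_size k \<longrightarrow> card U \<le> card T"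
    for n T and A :: "nat \<Rightarrow> nat \<Rightarrow> 'a"
  proof (rule ccontr)
    interpret fixed_transversal n A T by unfold_locales (rule T)
    assume "\<not> (1 - \<beta> / 4 - \<epsilon>) * n \<le> card T"
    then have small: "card T < (1 - \<beta> / 4 - \<epsilon>) * n" by simp
    have pos: "0 < n" using n unfolding n0_def by simp
    have "l i \<le> \<epsilon>\<^sup>2 / 4 * n" if "i < k" for i
    proof -
      have "l i \<le> (\<Sum>i<k. l i)" using that by (intro member_le_sum) (auto simp: l_def)
      moreover have "(\<Sum>i<k. l i) / (\<epsilon>\<^sup>2 / 4) \<le> n" using n unfolding n0_def by linarith
      then have "(\<Sum>i<k. l i) \<le> n * (\<epsilon>\<^sup>2 / 4)" using assms(1) by (subst (asm) pos_divide_le_eq) auto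
      ultimately show ?thesis by (simp add: mult.commute)
    qed
    then obtain E where E: "robust (swap_size k) (exceptions (\<epsilon>\<^sup>2 / 4) k) E"
      "k * (\<epsilon>\<^sup>2 / 2) * n \<le> card E"
      using robust_sequence[OF assms pos sq _ small, of k k] opt
      unfolding locally_optimal_def l_def by blast
    have "2 / \<epsilon>\<^sup>2 < k" unfolding k_def by linarith
    then have "1 < k * (\<epsilon>\<^sup>2 / 2)" using assms(1) by (simp add: pos_divide_less_eq)
    then have "n < k * (\<epsilon>\<^sup>2 / 2) * n" using pos by simp
    moreover have "card E \<le> n"
      using E(1) card_mono[OF transversalD(1)[OF T], of E] transversalD(7)[OF T]
      unfolding robust_def by simp
    ultimately show False using E(2) by linarith
  qed
  then show ?thesis by (intro exI[of _ "swap_size k"] exI[of _ n0] allI impI)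
qed

section \<open>A program logic with time bounds\<close>

text \<open>Total correctness with a time bound: as \<open>exec\<close> is deterministic, the run
  asserted to exist is the only one.\<close>

definition runs :: "com \<Rightarrow> mem \<Rightarrow> nat \<Rightarrow> (mem \<Rightarrow> bool) \<Rightarrow> bool" where
  "runs c s B Q \<longleftrightarrow> (\<exists>t s'. exec c s t s' \<and> t \<le> B \<and> Q s')"

lemma runs_weaken:
  "runs c s B Q \<Longrightarrow> B \<le> B' \<Longrightarrow> (\<And>s'. Q s' \<Longrightarrow> Q' s') \<Longrightarrow> runs c s B' Q'"
  unfolding runs_def by (meson order_trans)

lemma runs_Skip: "1 \<le> B \<Longrightarrow> Q s \<Longrightarrow> runs Skip s B Q"
  unfolding runs_def using exec.Skip by blast

lemma runs_Put:
  "1 + acost i + acost a \<le> B \<Longrightarrow> Q (s(x := (s x)(aval i s := aval a s))) \<Longrightarrow> runs (Put x i a) s B Q"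
  unfolding runs_def using exec.Put by blast

lemma runs_Seq:
  assumes "runs c1 s D R" "\<And>s'. R s' \<Longrightarrow> runs c2 s' D' Q" "1 + D + D' \<le> B"
  shows "runs (Seq c1 c2) s B Q"
proof -
  obtain t1 s1 where 1: "exec c1 s t1 s1" "t1 \<le> D" "R s1" using assms(1) unfolding runs_def by blast
  obtain t2 s2 where 2: "exec c2 s1 t2 s2" "t2 \<le> D'" "Q s2"
    using assms(2)[OF 1(3)] unfolding runs_def by blast
  have "1 + t1 + t2 \<le> B" using 1 2 assms(3) by linarith
  then show ?thesis unfolding runs_def using exec.Seq[OF 1(1) 2(1)] 2(3) by blast
qed

lemma runs_Put_Seq:
  assumes "runs c (s(x := (s x)(aval i s := aval a s))) D Q" "2 + acost i + acost a + D \<le> B"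
  shows "runs (Seq (Put x i a) c) s B Q"
  by (rule runs_Seq[OF runs_Put[where Q = "\<lambda>s'. s' = s(x := (s x)(aval i s := aval a s))"]])
    (use assms in auto)

lemma runs_Cond:
  assumes "bval b s \<Longrightarrow> runs c1 s D Q" "\<not> bval b s \<Longrightarrow> runs c2 s D Q" "1 + bcost b + D \<le> B"
  shows "runs (Cond b c1 c2) s B Q"
proof (cases "bval b s")
  case True
  then obtain t s' where "exec c1 s t s'" "t \<le> D" "Q s'" using assms(1) unfolding runs_def by blast
  then show ?thesis unfolding runs_def using exec.CondTrue[OF True] assms(3)
    by (meson add_le_cancel_left order_trans)
next
  case False
  then obtain t s' where "exec c2 s t s'" "t \<le> D" "Q s'" using assms(2) unfolding runs_def by blast
  then show ?thesis unfolding runs_def using exec.CondFalse[OF False] assms(3)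
    by (meson add_le_cancel_left order_trans)
qed

lemma runs_While_False: "\<not> bval b s \<Longrightarrow> 1 + bcost b \<le> B \<Longrightarrow> Q s \<Longrightarrow> runs (While b c) s B Q"
  unfolding runs_def using exec.WhileFalse by blast

text \<open>The counter may be any cell of an array, so that nested loops can share one
  array.\<close>

definition for_loop :: "string \<Rightarrow> nat \<Rightarrow> aexp \<Rightarrow> com \<Rightarrow> com" where
  "for_loop x j N c = Seq (Put x (Const j) (Const 0))
     (While (Less (Get x (Const j)) N)
       (Seq c (Put x (Const j) (Plus (Get x (Const j)) (Const 1)))))"

text \<open>The invariant refers to the memory after the counter update. The bound \<open>N\<close>
  is evaluated anew in every round and must keep its value \<open>V\<close>. A round costs
  \<open>acost N + 4\<close> for the test, \<open>B\<close> for the body and 7 for sequencing and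
  increment.\<close>

lemma runs_for:
  assumes init: "I 0 (s(x := (s x)(j := 0)))"
    and step: "\<And>k s. k < V \<Longrightarrow> s x j = k \<Longrightarrow> I k s \<Longrightarrow>
      runs c s B (\<lambda>s'. s' x j = k \<and> I (Suc k) (s'(x := (s' x)(j := Suc k))))"
    and val: "\<And>k s. s x j = k \<Longrightarrow> I k s \<Longrightarrow> aval N s = V"
    and le: "V * (B + acost N + 11) + acost N + 8 \<le> B'"
  shows "runs (for_loop x j N c) s B' (I V)"
proof -
  let ?w = "While (Less (Get x (Const j)) N)
       (Seq c (Put x (Const j) (Plus (Get x (Const j)) (Const 1))))"
  have loop: "runs ?w s ((V - k) * (B + acost N + 11) + acost N + 4) (I V)"
    if "s x j = k" "I k s" "k \<le> V" for k s
    using that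
  proof (induction "V - k" arbitrary: k s)
    case 0
    have "k = V" using 0 by simp
    then have "\<not> bval (Less (Get x (Const j)) N) s" using 0 val[OF 0(2,3)] by simp
    then show ?case using 0 \<open>k = V\<close> by (intro runs_While_False) auto
  next
    case (Suc d)
    have k: "k < V" using Suc by simp
    have b: "bval (Less (Get x (Const j)) N) s" using Suc.prems val[OF Suc.prems(1,2)] k by simp
    obtain t1 s1 where 1: "exec c s t1 s1" "t1 \<le> B" "s1 x j = k"
      and I1: "I (Suc k) (s1(x := (s1 x)(j := Suc k)))"
      using step[OF k Suc.prems(1,2)] unfolding runs_def by blast
    let ?s2 = "s1(x := (s1 x)(j := Suc k))"
    have "exec (Put x (Const j) (Plus (Get x (Const j)) (Const 1))) s1 6 ?s2"
      using exec.Put[of x "Const j" "Plus (Get x (Const j)) (Const 1)" s1] 1(3)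
      by (simp add: eval_nat_numeral)
    note e = exec.Seq[OF 1(1) this]
    have "runs ?w ?s2 ((V - Suc k) * (B + acost N + 11) + acost N + 4) (I V)"
      using Suc.hyps(1)[of "Suc k" ?s2] Suc.hyps(2) I1 k by simp
    then obtain t2 s3 where 2: "exec ?w ?s2 t2 s3" "I V s3"
      "t2 \<le> (V - Suc k) * (B + acost N + 11) + acost N + 4"
      unfolding runs_def by blast
    have "1 + bcost (Less (Get x (Const j)) N) + (1 + t1 + 6) + t2
        \<le> (B + acost N + 11) + ((V - Suc k) * (B + acost N + 11) + acost N + 4)"
      using 1(2) 2(3) by simp
    also have "\<dots> = (V - k) * (B + acost N + 11) + acost N + 4"
      using k by (metis Suc_diff_Suc add.assoc mult_Suc)
    finally show ?case
      unfolding runs_def using exec.WhileTrue[OF b e 2(1)] 2(2) by blast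
  qed
  show ?thesis
    unfolding for_loop_def
    by (rule runs_Put_Seq[OF loop[of _ 0]]) (use init le in auto)
qed

section \<open>Greedy completion\<close>

text \<open>An entry already present conflicts with itself, so repetitions are rejected too.\<close>

definition add_free :: "(nat \<Rightarrow> nat \<Rightarrow> 'a) \<Rightarrow> (nat \<times> nat) list \<Rightarrow> nat \<times> nat \<Rightarrow> (nat \<times> nat) list" where
  "add_free A xs e =
     (if \<forall>x\<in>set xs. fst e \<noteq> fst x \<and> snd e \<noteq> snd x \<and> symb A e \<noteq> symb A x then xs @ [e] else xs)"

definition valid :: "nat \<Rightarrow> (nat \<Rightarrow> nat \<Rightarrow> 'a) \<Rightarrow> (nat \<times> nat) list \<Rightarrow> bool" where
  "valid n A xs \<longleftrightarrow> distinct xs \<and> transversal n A (set xs)"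

text \<open>Row starts are read from the table \<open>off\<close>, so that a lookup needs only
  addition.\<close>

definition env :: "nat \<Rightarrow> (nat \<Rightarrow> nat \<Rightarrow> nat) \<Rightarrow> mem \<Rightarrow> bool" where
  "env n A s \<longleftrightarrow> s ''n'' 0 = n \<and> (\<forall>i<n. \<forall>j<n. s ''A'' (s ''off'' i + j) = A i j)"

definition stored :: "string \<Rightarrow> string \<Rightarrow> string \<Rightarrow> mem \<Rightarrow> (nat \<times> nat) list" where
  "stored x y z s = map (\<lambda>k. (s x k, s y k)) [0..<s z 0]"

abbreviation Var :: "string \<Rightarrow> aexp" where
  "Var x \<equiv> Get x (Const 0)"

definition neq :: "aexp \<Rightarrow> aexp \<Rightarrow> bexp" where
  "neq a b = Neg (Conj (Neg (Less a b)) (Neg (Less b a)))"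

lemma neq_simps [simp]:
  "bval (neq a b) s \<longleftrightarrow> aval a s \<noteq> aval b s"
  "bcost (neq a b) = 6 + 2 * (acost a + acost b)"
  unfolding neq_def by auto

definition entry :: "aexp \<Rightarrow> aexp \<Rightarrow> aexp" where
  "entry a b = Get ''A'' (Plus (Get ''off'' a) b)"

lemma entry_simps [simp]:
  "aval (entry a b) s = s ''A'' (s ''off'' (aval a s) + aval b s)"
  "acost (entry a b) = 3 + acost a + acost b"
  unfolding entry_def by auto

section \<open>The search program\<close>

definition scan_conflicts :: com where
  "scan_conflicts = for_loop ''l'' 0 (Var ''m'')
     (Cond (Conj (neq (Var ''i'') (Get ''r'' (Var ''l'')))
           (Conj (neq (Var ''j'') (Get ''c'' (Var ''l'')))
                 (neq (entry (Var ''i'') (Var ''j''))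
                      (entry (Get ''r'' (Var ''l'')) (Get ''c'' (Var ''l''))))))
        Skip
        (Put ''f'' (Const 0) (Const 1)))"

definition append_entry :: com where
  "append_entry = Cond (Less (Var ''f'') (Const 1))
     (Seq (Put ''r'' (Var ''m'') (Var ''i''))
     (Seq (Put ''c'' (Var ''m'') (Var ''j''))
          (Put ''m'' (Const 0) (Plus (Var ''m'') (Const 1)))))
     Skip"

definition add_entry :: "aexp \<Rightarrow> aexp \<Rightarrow> com" where
  "add_entry a b =
     Seq (Put ''i'' (Const 0) a)
    (Seq (Put ''j'' (Const 0) b)
    (Seq (Put ''f'' (Const 0) (Const 0))
    (Seq scan_conflicts append_entry)))"

definition scratch :: "string set" where
  "scratch = {''i'', ''j'', ''f'', ''l'', ''r'', ''c'', ''m''}"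

abbreviation work :: "mem \<Rightarrow> (nat \<times> nat) list" where
  "work \<equiv> stored ''r'' ''c'' ''m''"

text \<open>The flag \<open>f\<close> stays 0 exactly as long as no stored entry conflicts. Since
  \<open>b\<close> is evaluated after \<open>i\<close> has been overwritten, its value must not
  depend on \<open>i\<close>.\<close>

lemma runs_add_entry:
  assumes env: "env n A s" and a: "aval a s = i" and b: "\<And>h. aval b (s(''i'' := h)) = j"
    and ij: "i < n" "j < n" and w: "set (work s) \<subseteq> {..<n} \<times> {..<n}" and m: "s ''m'' 0 \<le> n"
  shows "runs (add_entry a b) s (n * 100 + 100 + acost a + acost b)
    (\<lambda>s'. work s' = add_free A (work s) (i, j) \<and> (\<forall>x. x \<notin> scratch \<longrightarrow> s' x = s x))"
proof -
  define s1 where "s1 = s(''i'' := (s ''i'')(0 := i), ''j'' := (s ''j'')(0 := j), ''f'' := (s ''f'')(0 := 0))"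
  define ok where "ok p \<longleftrightarrow> i \<noteq> s ''r'' p \<and> j \<noteq> s ''c'' p \<and> A i j \<noteq> A (s ''r'' p) (s ''c'' p)" for p
  define I where "I k t \<longleftrightarrow> (\<forall>x. x \<notin> {''f'', ''l''} \<longrightarrow> t x = s1 x) \<and>
    (t ''f'' 0 = 0 \<longleftrightarrow> (\<forall>p<k. ok p))" for k t
  have w': "s ''r'' p < n \<and> s ''c'' p < n" if "p < s ''m'' 0" for p
    using w that by (auto simp: stored_def image_subset_iff)
  have cost: "s ''m'' 0 * (76 + acost (Var ''m'') + 11) + acost (Var ''m'') + 8 \<le> n * 100 + 20"
    using mult_le_mono1[OF m, of 89] by simp
  have scan: "runs scan_conflicts s1 (n * 100 + 20) (I (s ''m'' 0))"
    unfolding scan_conflicts_def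
  \<comment> \<open>The number 76 is 1 for the conditional, 72 for its test and 3 for the dearer
    branch.\<close>
  proof (rule runs_for[where B = 76, OF _ _ _ cost])
    show "I 0 (s1(''l'' := (s1 ''l'')(0 := 0)))" unfolding I_def s1_def by simp
    show "aval (Var ''m'') t = s ''m'' 0" if "I k t" for k t
      using that unfolding I_def s1_def by simp
    fix k t assume k: "k < s ''m'' 0" and l: "t ''l'' 0 = k" and I: "I k t"
    have t: "t ''i'' 0 = i" "t ''j'' 0 = j" "t ''r'' k = s ''r'' k" "t ''c'' k = s ''c'' k"
      "t ''A'' = s ''A''" "t ''off'' = s ''off''"
      using I unfolding I_def s1_def by simp_all
    have A: "s ''A'' (s ''off'' i + j) = A i j"
      "s ''A'' (s ''off'' (s ''r'' k) + s ''c'' k) = A (s ''r'' k) (s ''c'' k)"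
      using env w'[OF k] ij unfolding env_def by simp_all
    have all: "(\<forall>p<Suc k. ok p) \<longleftrightarrow> (\<forall>p<k. ok p) \<and> ok k" using less_Suc_eq by auto
    show "runs (Cond (Conj (neq (Var ''i'') (Get ''r'' (Var ''l'')))
           (Conj (neq (Var ''j'') (Get ''c'' (Var ''l'')))
                 (neq (entry (Var ''i'') (Var ''j''))
                      (entry (Get ''r'' (Var ''l'')) (Get ''c'' (Var ''l''))))))
        Skip
        (Put ''f'' (Const 0) (Const 1))) t 76
      (\<lambda>t'. t' ''l'' 0 = k \<and> I (Suc k) (t'(''l'' := (t' ''l'')(0 := Suc k))))"
    proof (rule runs_Cond[where D = 3], goal_cases)
      case 1
      then have "ok k" unfolding ok_def using t A l by simp
      then show ?case using I l all unfolding I_def by (intro runs_Skip) auto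
    next
      case 2
      then have "\<not> ok k" unfolding ok_def using t A l by simp
      then show ?case using I l all unfolding I_def by (intro runs_Put) auto
    qed simp
  qed
  have append: "runs append_entry t 40
      (\<lambda>s'. work s' = add_free A (work s) (i, j) \<and> (\<forall>x. x \<notin> scratch \<longrightarrow> s' x = s x))"
    if I: "I (s ''m'' 0) t" for t
  proof -
    have t: "t ''i'' 0 = i" "t ''j'' 0 = j" "t ''m'' = s ''m''" "t ''r'' = s ''r''" "t ''c'' = s ''c''"
      using I unfolding I_def s1_def by simp_all
    have fr: "t x = s x" if "x \<notin> scratch" for x
      using I that unfolding I_def s1_def scratch_def by simp
    have free: "t ''f'' 0 < 1 \<longleftrightarrow>
        (\<forall>x\<in>set (work s). fst (i, j) \<noteq> fst x \<and> snd (i, j) \<noteq> snd x \<and> symb A (i, j) \<noteq> symb A x)"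
    proof -
      have "t ''f'' 0 < 1 \<longleftrightarrow> (\<forall>p<s ''m'' 0. ok p)" using I unfolding I_def by simp
      also have "\<dots> \<longleftrightarrow> (\<forall>x\<in>set (work s).
          fst (i, j) \<noteq> fst x \<and> snd (i, j) \<noteq> snd x \<and> symb A (i, j) \<noteq> symb A x)"
        by (simp add: stored_def ok_def symb_def) (simp add: Ball_def)
      finally show ?thesis .
    qed
    show ?thesis
      unfolding append_entry_def
    proof (rule runs_Cond[where D = 30], goal_cases)
      case 1
      then have add: "add_free A (work s) (i, j) = work s @ [(i, j)]"
        using free by (simp add: add_free_def)
      show ?case
      proof (rule runs_Put_Seq[where D = 20], rule runs_Put_Seq[where D = 10], rule runs_Put, goal_cases)
        case 2
        show ?case
          unfolding add using fr by (auto simp: t stored_def scratch_def)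
      qed simp_all
    next
      case 2
      then have add: "add_free A (work s) (i, j) = work s"
        using free by (simp add: add_free_def)
      show ?case
        unfolding add using fr by (intro runs_Skip) (auto simp: t stored_def)
    qed simp
  qed
  have main: "runs (Seq scan_conflicts append_entry) s1 (n * 100 + 70)
      (\<lambda>s'. work s' = add_free A (work s) (i, j) \<and> (\<forall>x. x \<notin> scratch \<longrightarrow> s' x = s x))"
    by (rule runs_Seq[OF scan append]) auto
  show ?thesis
    unfolding add_entry_def
    by (rule runs_Put_Seq[where D = "n * 100 + 90 + acost b"],
      rule runs_Put_Seq[where D = "n * 100 + 80"],
      rule runs_Put_Seq[where D = "n * 100 + 70"])
      (use main in \<open>simp_all add: s1_def a b\<close>)
qed

section \<open>Correctness of greedy completion\<close>

lemma valid_bounds: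
  assumes "valid n A xs"
  shows "length xs \<le> n" "set xs \<subseteq> {..<n} \<times> {..<n}"
  using assms transversalD(7) distinct_card unfolding valid_def transversal_iff by (metis, simp)

lemma valid_add_free:
  assumes "valid n A xs" "e \<in> {..<n} \<times> {..<n}"
  shows "valid n A (add_free A xs e)"
proof (cases "\<forall>x\<in>set xs. fst e \<noteq> fst x \<and> snd e \<noteq> snd x \<and> symb A e \<noteq> symb A x")
  case True
  have "transversal n A (insert e (set xs))"
    by (rule transversal_insert) (use assms True in \<open>auto simp: valid_def\<close>)
  then show ?thesis using True assms by (auto simp: valid_def add_free_def)
next
  case False
  then show ?thesis using assms(1) unfolding add_free_def by auto
qed

lemma valid_foldl:
  "valid n A xs \<Longrightarrow> set ys \<subseteq> {..<n} \<times> {..<n} \<Longrightarrow> valid n A (foldl (add_free A) xs ys)"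
  by (induction ys arbitrary: xs) (auto intro: valid_add_free)

lemma set_foldl_add_free:
  "set xs \<subseteq> set (foldl (add_free A) xs ys)"
  "set (foldl (add_free A) xs ys) \<subseteq> set xs \<union> set ys"
proof (induction ys arbitrary: xs)
  case (Cons y ys)
  {
    case 1
    have "set xs \<subseteq> set (add_free A xs y)" unfolding add_free_def by auto
    then show ?case using Cons.IH(1)[of "add_free A xs y"] by simp
  next
    case 2
    have "set (add_free A xs y) \<subseteq> insert y (set xs)" unfolding add_free_def by auto
    then show ?case using Cons.IH(2)[of "add_free A xs y"] by simp blast
  }
qed auto

text \<open>Only entries of \<open>xs\<close> and \<open>ys\<close> are ever present, so
  \<open>e\<close> can be refused only because it is already there.\<close>

lemma mem_foldl_add_free:
  assumes "e \<in> set ys"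
    and "\<And>x. x \<in> set xs \<union> set ys \<Longrightarrow> x \<noteq> e \<Longrightarrow>
      fst e \<noteq> fst x \<and> snd e \<noteq> snd x \<and> symb A e \<noteq> symb A x"
  shows "e \<in> set (foldl (add_free A) xs ys)"
  using assms
proof (induction ys arbitrary: xs)
  case (Cons y ys)
  have sub: "set (add_free A xs y) \<subseteq> insert y (set xs)" unfolding add_free_def by auto
  show ?case
  proof (cases "e \<in> set ys")
    case True
    then have "e \<in> set (foldl (add_free A) (add_free A xs y) ys)"
      by (rule Cons.IH) (use Cons.prems(2) sub in auto)
    then show ?thesis by simp
  next
    case False
    then have y: "y = e" using Cons.prems(1) by simp
    have "e \<in> set (add_free A xs y)"
    proof (cases "e \<in> set xs")
      case True
      then show ?thesis unfolding add_free_def by auto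
    next
      case False
      then have "\<forall>x\<in>set xs. fst e \<noteq> fst x \<and> snd e \<noteq> snd x \<and> symb A e \<noteq> symb A x"
        using Cons.prems(2) by fastforce
      then show ?thesis using y by (simp add: add_free_def)
    qed
    then show ?thesis using set_foldl_add_free(1)[of "add_free A xs y" A ys] by auto
  qed
qed simp

text \<open>New entries go first and old ones fill up afterwards, so conflicting old entries drop
  out without any deletion.\<close>

definition greedy ::
  "(nat \<Rightarrow> nat \<Rightarrow> 'a) \<Rightarrow> (nat \<times> nat) list \<Rightarrow> (nat \<times> nat) list \<Rightarrow> (nat \<times> nat) list" where
  "greedy A ys ts = foldl (add_free A) (foldl (add_free A) [] ys) ts"

definition improve ::
  "(nat \<Rightarrow> nat \<Rightarrow> 'a) \<Rightarrow> (nat \<times> nat) list \<Rightarrow> (nat \<times> nat) list \<Rightarrow> (nat \<times> nat) list" where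
  "improve A ys ts = (if length ts < length (greedy A ys ts) then greedy A ys ts else ts)"

text \<open>\<open>2 * M\<close> digits encode \<open>M\<close> entries, all rows before all
  columns, so that nested counters can enumerate them.\<close>

definition tuple :: "nat \<Rightarrow> (nat \<Rightarrow> nat) \<Rightarrow> (nat \<times> nat) list" where
  "tuple M d = map (\<lambda>j. (d j, d (M + j))) [0..<M]"

lemma set_tuple: "(\<And>j. j < 2 * M \<Longrightarrow> d j < n) \<Longrightarrow> set (tuple M d) \<subseteq> {..<n} \<times> {..<n}"
  unfolding tuple_def by auto

lemma valid_Nil: "valid n A []"
  by (simp add: valid_def transversal_def)

lemma valid_greedy:
  "valid n A ts \<Longrightarrow> set ys \<subseteq> {..<n} \<times> {..<n} \<Longrightarrow> valid n A (greedy A ys ts)"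
  unfolding greedy_def by (rule valid_foldl[OF valid_foldl[OF valid_Nil] valid_bounds(2)])

lemma transversal_distinct_lines:
  assumes "transversal n A U" "e \<in> U" "x \<in> U" "x \<noteq> e"
  shows "fst e \<noteq> fst x \<and> snd e \<noteq> snd x \<and> symb A e \<noteq> symb A x"
  using transversalD(2-4)[OF assms(1)] assms(2-4) by (metis inj_onD)

text \<open>Entries of \<open>U\<close> do not conflict with one another, and those in
  \<open>ts\<close> do not conflict with the rest of \<open>ts\<close> either; hence all are
  accepted.\<close>

lemma greedy_superset:
  assumes ts: "valid n A ts" and U: "transversal n A U" and ys: "set ys = U - set ts"
  shows "U \<subseteq> set (greedy A ys ts)"
proof
  fix e assume e: "e \<in> U"
  have sub: "set (foldl (add_free A) [] ys) \<subseteq> U" using set_foldl_add_free(2)[of A "[]" ys] ys by auto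
  show "e \<in> set (greedy A ys ts)"
  proof (cases "e \<in> set ts")
    case True
    have "fst e \<noteq> fst x \<and> snd e \<noteq> snd x \<and> symb A e \<noteq> symb A x"
      if "x \<in> set (foldl (add_free A) [] ys) \<union> set ts" "x \<noteq> e" for x
      using that(1)
    proof
      assume "x \<in> set (foldl (add_free A) [] ys)"
      then show ?thesis using transversal_distinct_lines[OF U e _ that(2)] sub by blast
    next
      assume "x \<in> set ts"
      then show ?thesis
        using transversal_distinct_lines[OF _ True _ that(2)] ts unfolding valid_def by blast
    qed
    then show ?thesis unfolding greedy_def by (intro mem_foldl_add_free[OF True]) auto
  next
    case False
    have "e \<in> set (foldl (add_free A) [] ys)"
    proof (rule mem_foldl_add_free)
      show "e \<in> set ys" using False e ys by simp
      show "fst e \<noteq> fst x \<and> snd e \<noteq> snd x \<and> symb A e \<noteq> symb A x"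
        if "x \<in> set [] \<union> set ys" "x \<noteq> e" for x
        using that ys by (intro transversal_distinct_lines[OF U e]) auto
    qed
    then show ?thesis unfolding greedy_def using set_foldl_add_free(1) by blast
  qed
qed

lemma improving_tuple:
  assumes ts: "valid n A ts" and U: "transversal n A U"
    and M: "card (U - set ts) \<le> M" and less: "card (set ts) < card U"
  obtains d where "\<And>j. j < 2 * M \<Longrightarrow> d j < n" "length ts < length (greedy A (tuple M d) ts)"
proof -
  have fU: "finite U" using transversalD(1)[OF U] .
  then obtain ys where ys: "set ys = U - set ts" "distinct ys"
    using finite_distinct_list[of "U - set ts"] by auto
  have "\<not> U \<subseteq> set ts" using less card_mono[of "set ts" U] by auto
  then have ne: "ys \<noteq> []" using ys(1) by auto
  have len: "length ys \<le> M" using ys M distinct_card by metis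
  \<comment> \<open>Tuples have length exactly \<open>M\<close>; the list is padded with copies of
    its head, which leave its set unchanged.\<close>
  define zs where "zs = ys @ replicate (M - length ys) (hd ys)"
  have zs: "length zs = M" "set zs = U - set ts"
  proof -
    show "length zs = M" using len unfolding zs_def by simp
    have "set zs = set ys" using hd_in_set[OF ne] unfolding zs_def by auto
    then show "set zs = U - set ts" using ys(1) by simp
  qed
  define d where "d j = (if j < M then fst (zs ! j) else snd (zs ! (j - M)))" for j
  have zn: "fst (zs ! j) < n \<and> snd (zs ! j) < n" if "j < M" for j
  proof -
    have "zs ! j \<in> U" using nth_mem[of j zs] zs that by auto
    then show ?thesis using transversalD(5,6)[OF U] by auto
  qed
  have "d j < n" if "j < 2 * M" for j
    using zn[of j] zn[of "j - M"] that unfolding d_def by auto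
  moreover have "tuple M d = zs"
    using zs(1) by (intro nth_equalityI) (auto simp: tuple_def d_def)
  moreover have "length ts < length (greedy A zs ts)"
  proof -
    have "card U \<le> card (set (greedy A zs ts))"
      using greedy_superset[OF ts U zs(2)] by (intro card_mono) auto
    also have "\<dots> \<le> length (greedy A zs ts)" by (rule card_length)
    finally show ?thesis using less ts distinct_card unfolding valid_def by fastforce
  qed
  ultimately show ?thesis using that by blast
qed

section \<open>One improvement step as a program\<close>

definition add_all :: "aexp \<Rightarrow> aexp \<Rightarrow> aexp \<Rightarrow> com" where
  "add_all a b N = for_loop ''k'' 0 N (add_entry a b)"

text \<open>The expressions may depend only on the counter and on arrays that the body leaves alone.
  The working list stays valid, hence of length at most \<open>n\<close>, which bounds the cost of
  each addition.\<close>

lemma runs_add_all: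
  assumes env: "env n A s" and w: "valid n A (work s)"
    and ab: "\<And>t. (\<And>x. x \<notin> insert ''k'' scratch \<Longrightarrow> t x = s x) \<Longrightarrow>
      aval a t = P (t ''k'' 0) \<and> aval b t = Q (t ''k'' 0) \<and> aval N t = V"
    and PQ: "\<And>k. k < V \<Longrightarrow> P k < n \<and> Q k < n"
    and B: "V * (n * 100 + 100 + acost a + acost b + acost N + 11) + acost N + 8 \<le> B"
  shows "runs (add_all a b N) s B
    (\<lambda>s'. work s' = foldl (add_free A) (work s) (map (\<lambda>k. (P k, Q k)) [0..<V]) \<and>
      (\<forall>x. x \<notin> insert ''k'' scratch \<longrightarrow> s' x = s x))"
proof -
  define I where "I k t \<longleftrightarrow> work t = foldl (add_free A) (work s) (map (\<lambda>k. (P k, Q k)) [0..<k]) \<and>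
    (\<forall>x. x \<notin> insert ''k'' scratch \<longrightarrow> t x = s x)" for k t
  have "runs (add_all a b N) s B (I V)"
    unfolding add_all_def
  proof (rule runs_for[OF _ _ _ B])
    show "I 0 (s(''k'' := (s ''k'')(0 := 0)))" unfolding I_def by (simp add: stored_def)
    show "aval N t = V" if "I k t" for k t
      using that ab[of t] unfolding I_def by blast
    fix k t assume k: "k < V" and tk: "t ''k'' 0 = k" and I: "I k t"
    have t: "work t = foldl (add_free A) (work s) (map (\<lambda>k. (P k, Q k)) [0..<k])"
      and fr: "\<And>x. x \<notin> insert ''k'' scratch \<Longrightarrow> t x = s x"
      using I unfolding I_def by auto
    have envt: "env n A t"
      using env fr[of "''n''"] fr[of "''A''"] fr[of "''off''"] unfolding env_def scratch_def by simp
    have "valid n A (work t)"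
      unfolding t by (rule valid_foldl[OF w]) (use PQ k in auto)
    note wt = valid_bounds[OF this]
    have "runs (add_entry a b) t (n * 100 + 100 + acost a + acost b)
      (\<lambda>s'. work s' = add_free A (work t) (P k, Q k) \<and> (\<forall>x. x \<notin> scratch \<longrightarrow> s' x = t x))"
    proof (rule runs_add_entry[OF envt])
      show "aval a t = P k" using ab[OF fr] tk by simp
      show "aval b (t(''i'' := h)) = Q k" for h
        using ab[of "t(''i'' := h)"] fr tk by (simp add: scratch_def)
      show "t ''m'' 0 \<le> n" using wt(1) unfolding stored_def by simp
    qed (use PQ[OF k] wt(2) in auto)
    then show "runs (add_entry a b) t (n * 100 + 100 + acost a + acost b)
        (\<lambda>s'. s' ''k'' 0 = k \<and> I (Suc k) (s'(''k'' := (s' ''k'')(0 := Suc k))))"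
    proof (rule runs_weaken[OF _ order_refl])
      fix s' assume s': "work s' = add_free A (work t) (P k, Q k) \<and> (\<forall>x. x \<notin> scratch \<longrightarrow> s' x = t x)"
      have "work (s'(''k'' := h)) = work s'" for h by (simp add: stored_def)
      then show "s' ''k'' 0 = k \<and> I (Suc k) (s'(''k'' := (s' ''k'')(0 := Suc k)))"
        using s' tk fr unfolding I_def t by (simp add: scratch_def)
    qed
  qed
  then show ?thesis unfolding I_def .
qed

definition copy_work :: com where
  "copy_work =
     Seq (for_loop ''k'' 0 (Var ''m'')
           (Seq (Put ''row'' (Var ''k'') (Get ''r'' (Var ''k'')))
                (Put ''col'' (Var ''k'') (Get ''c'' (Var ''k'')))))
         (Put ''size'' (Const 0) (Var ''m''))"

text \<open>The candidate is built in separate arrays, so the current transversal survives until a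
  longer one is complete.\<close>

definition improve_step :: "nat \<Rightarrow> com" where
  "improve_step M =
     Seq (Put ''m'' (Const 0) (Const 0))
    (Seq (add_all (Get ''y'' (Var ''k'')) (Get ''y'' (Plus (Const M) (Var ''k''))) (Const M))
    (Seq (add_all (Get ''row'' (Var ''k'')) (Get ''col'' (Var ''k'')) (Var ''size''))
         (Cond (Less (Var ''size'') (Var ''m'')) copy_work Skip)))"

definition modified :: "string set" where
  "modified = insert ''k'' scratch \<union> {''row'', ''col'', ''size''}"

lemma result_stored: "result s = stored ''row'' ''col'' ''size'' s"
  unfolding result_def stored_def ..

lemma runs_copy_work:
  assumes m: "s ''m'' 0 \<le> n"
  shows "runs copy_work s (n * 26 + 20)
    (\<lambda>s'. result s' = work s \<and> (\<forall>x. x \<notin> {''k'', ''row'', ''col'', ''size''} \<longrightarrow> s' x = s x))"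
proof -
  define I where "I k t \<longleftrightarrow> (\<forall>p<k. t ''row'' p = s ''r'' p \<and> t ''col'' p = s ''c'' p) \<and>
    (\<forall>x. x \<notin> {''k'', ''row'', ''col''} \<longrightarrow> t x = s x)" for k t
  have B: "s ''m'' 0 * (13 + acost (Var ''m'') + 11) + acost (Var ''m'') + 8 \<le> n * 26 + 10"
    using mult_le_mono1[OF m, of 26] by simp
  show ?thesis
    unfolding copy_work_def
  proof (rule runs_Seq[where D' = 5])
    show "runs (for_loop ''k'' 0 (Var ''m'')
        (Seq (Put ''row'' (Var ''k'') (Get ''r'' (Var ''k'')))
             (Put ''col'' (Var ''k'') (Get ''c'' (Var ''k''))))) s (n * 26 + 10) (I (s ''m'' 0))"
    proof (rule runs_for[OF _ _ _ B])
      show "I 0 (s(''k'' := (s ''k'')(0 := 0)))" unfolding I_def by simp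
      show "aval (Var ''m'') t = s ''m'' 0" if "I k t" for k t using that unfolding I_def by simp
      fix k t assume k: "k < s ''m'' 0" and tk: "t ''k'' 0 = k" and I: "I k t"
      have t: "t ''r'' = s ''r''" "t ''c'' = s ''c''" using I unfolding I_def by simp_all
      show "runs (Seq (Put ''row'' (Var ''k'') (Get ''r'' (Var ''k'')))
             (Put ''col'' (Var ''k'') (Get ''c'' (Var ''k'')))) t 13
          (\<lambda>t'. t' ''k'' 0 = k \<and> I (Suc k) (t'(''k'' := (t' ''k'')(0 := Suc k))))"
      proof (rule runs_Put_Seq[where D = 6], rule runs_Put, goal_cases)
        case 2
        show ?case using I tk t unfolding I_def by (simp add: less_Suc_eq)
      qed simp_all
    qed
  next
    fix t assume I: "I (s ''m'' 0) t"
    have t: "t ''m'' = s ''m''" using I unfolding I_def by simp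
    show "runs (Put ''size'' (Const 0) (Var ''m'')) t 5
      (\<lambda>s'. result s' = work s \<and> (\<forall>x. x \<notin> {''k'', ''row'', ''col'', ''size''} \<longrightarrow> s' x = s x))"
      using I t unfolding I_def by (intro runs_Put) (simp_all add: result_stored stored_def)
  qed simp
qed

lemma runs_improve_step:
  assumes env: "env n A s" and v: "valid n A (result s)" and y: "\<And>j. j < 2 * M \<Longrightarrow> s ''y'' j < n"
  shows "runs (improve_step M) s (M * (n * 100 + 120) + n * (n * 100 + 150) + 100)
    (\<lambda>s'. result s' = improve A (tuple M (s ''y'')) (result s) \<and> (\<forall>x. x \<notin> modified \<longrightarrow> s' x = s x))"
proof -
  define s1 where "s1 = s(''m'' := (s ''m'')(0 := 0))"
  define ys where "ys = tuple M (s ''y'')"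
  have ys: "set ys \<subseteq> {..<n} \<times> {..<n}" unfolding ys_def by (rule set_tuple) (rule y)
  have env1: "env n A s1" using env unfolding env_def s1_def by simp
  have w1: "work s1 = []" unfolding s1_def stored_def by simp
  let ?fr = "\<lambda>t. \<forall>x. x \<notin> insert ''k'' scratch \<longrightarrow> t x = s x"
  have first: "runs (add_all (Get ''y'' (Var ''k'')) (Get ''y'' (Plus (Const M) (Var ''k''))) (Const M))
      s1 (M * (n * 100 + 120) + 9) (\<lambda>t. work t = foldl (add_free A) [] ys \<and> ?fr t)"
  proof (rule runs_weaken[OF runs_add_all[OF env1, where P = "s ''y''" and Q = "\<lambda>k. s ''y'' (M + k)" and V = M
      and B = "M * (n * 100 + 120) + 9"]])
    show "valid n A (work s1)" unfolding w1 by (rule valid_Nil)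
    show "aval (Get ''y'' (Var ''k'')) t = s ''y'' (t ''k'' 0) \<and>
        aval (Get ''y'' (Plus (Const M) (Var ''k''))) t = s ''y'' (M + t ''k'' 0) \<and> aval (Const M) t = M"
      if "\<And>x. x \<notin> insert ''k'' scratch \<Longrightarrow> t x = s1 x" for t
      using that[of "''y''"] unfolding s1_def scratch_def by simp
    show "s ''y'' k < n \<and> s ''y'' (M + k) < n" if "k < M" for k using y that by simp
    show "work t = foldl (add_free A) [] ys \<and> ?fr t"
      if "work t = foldl (add_free A) (work s1) (map (\<lambda>k. (s ''y'' k, s ''y'' (M + k))) [0..<M]) \<and>
        (\<forall>x. x \<notin> insert ''k'' scratch \<longrightarrow> t x = s1 x)" for t
      using that unfolding w1 ys_def tuple_def by (simp add: s1_def scratch_def)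
  qed simp_all
  have len: "s ''size'' 0 \<le> n" using valid_bounds(1)[OF v] unfolding result_def by simp
  have second: "runs (add_all (Get ''row'' (Var ''k'')) (Get ''col'' (Var ''k'')) (Var ''size''))
      t (n * (n * 100 + 119) + 10) (\<lambda>t'. work t' = greedy A ys (result s) \<and> ?fr t')"
    if t: "work t = foldl (add_free A) [] ys \<and> ?fr t" for t
  proof (rule runs_weaken[OF runs_add_all[where n = n and A = A and P = "s ''row''" and Q = "s ''col''" and V = "s ''size'' 0"
      and B = "n * (n * 100 + 119) + 10"]])
    have fr: "t x = s x" if "x \<notin> insert ''k'' scratch" for x using t that by blast
    show "env n A t"
      using env fr[of "''n''"] fr[of "''A''"] fr[of "''off''"] unfolding env_def scratch_def by simp
    show "valid n A (work t)" using valid_foldl[OF valid_Nil ys] t by simp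
    show "aval (Get ''row'' (Var ''k'')) t' = s ''row'' (t' ''k'' 0) \<and>
        aval (Get ''col'' (Var ''k'')) t' = s ''col'' (t' ''k'' 0) \<and> aval (Var ''size'') t' = s ''size'' 0"
      if "\<And>x. x \<notin> insert ''k'' scratch \<Longrightarrow> t' x = t x" for t'
      using that[of "''row''"] that[of "''col''"] that[of "''size''"]
        fr[of "''row''"] fr[of "''col''"] fr[of "''size''"] by (simp add: scratch_def)
    show "s ''row'' k < n \<and> s ''col'' k < n" if "k < s ''size'' 0" for k
      using valid_bounds(2)[OF v] that by (auto simp: result_def image_subset_iff)
    show "s ''size'' 0 * (n * 100 + 100 + acost (Get ''row'' (Var ''k'')) + acost (Get ''col'' (Var ''k'')) +
        acost (Var ''size'') + 11) + acost (Var ''size'') + 8 \<le> n * (n * 100 + 119) + 10"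
      using mult_le_mono1[OF len, of "n * 100 + 119"] by (simp add: algebra_simps)
    show "work t' = greedy A ys (result s) \<and> ?fr t'"
      if "work t' = foldl (add_free A) (work t) (map (\<lambda>k. (s ''row'' k, s ''col'' k)) [0..<s ''size'' 0]) \<and>
        (\<forall>x. x \<notin> insert ''k'' scratch \<longrightarrow> t' x = t x)" for t'
      using that t unfolding greedy_def result_def by simp
  qed simp
  have third: "runs (Cond (Less (Var ''size'') (Var ''m'')) copy_work Skip) t (n * 26 + 30)
      (\<lambda>s'. result s' = improve A ys (result s) \<and> (\<forall>x. x \<notin> modified \<longrightarrow> s' x = s x))"
    if t: "work t = greedy A ys (result s) \<and> ?fr t" for t
  proof -
    have fr: "t x = s x" if "x \<notin> insert ''k'' scratch" for x using t that by blast
    have lens: "length (result s) = t ''size'' 0" "length (work t) = t ''m'' 0"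
      using fr[of "''size''"] unfolding result_def stored_def scratch_def by simp_all
    have r: "result t = result s"
      using fr[of "''row''"] fr[of "''col''"] fr[of "''size''"] unfolding result_def scratch_def by simp
    have mod: "x \<notin> insert ''k'' scratch \<and> x \<notin> {''k'', ''row'', ''col'', ''size''}" if "x \<notin> modified" for x
      using that unfolding modified_def by auto
    show ?thesis
    proof (rule runs_Cond[where D = "n * 26 + 20"], goal_cases)
      case 1
      have "t ''m'' 0 \<le> n" using valid_bounds(1)[OF valid_greedy[OF v ys]] t lens(2) by simp
      from runs_copy_work[of t, OF this] show ?case
      proof (rule runs_weaken[OF _ order_refl])
        fix s' assume s': "result s' = work t \<and> (\<forall>x. x \<notin> {''k'', ''row'', ''col'', ''size''} \<longrightarrow> s' x = t x)"
        have "length (result s) < length (greedy A ys (result s))" using 1 lens t by simp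
        then show "result s' = improve A ys (result s) \<and> (\<forall>x. x \<notin> modified \<longrightarrow> s' x = s x)"
          using s' t mod fr unfolding improve_def by auto
      qed
    next
      case 2
      have "\<not> length (result s) < length (greedy A ys (result s))" using 2 lens t by simp
      then show ?case
        using r mod fr unfolding improve_def by (intro runs_Skip) auto
    qed simp
  qed
  have "runs (improve_step M) s (M * (n * 100 + 120) + n * (n * 100 + 150) + 100)
    (\<lambda>s'. result s' = improve A ys (result s) \<and> (\<forall>x. x \<notin> modified \<longrightarrow> s' x = s x))"
    unfolding improve_step_def
  proof (rule runs_Put_Seq)
    show "runs (Seq (add_all (Get ''y'' (Var ''k'')) (Get ''y'' (Plus (Const M) (Var ''k''))) (Const M))
       (Seq (add_all (Get ''row'' (Var ''k'')) (Get ''col'' (Var ''k'')) (Var ''size''))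
         (Cond (Less (Var ''size'') (Var ''m'')) copy_work Skip)))
      (s(''m'' := (s ''m'')(aval (Const 0) s := aval (Const 0) s)))
      (M * (n * 100 + 120) + n * (n * 100 + 150) + 90)
      (\<lambda>s'. result s' = improve A ys (result s) \<and> (\<forall>x. x \<notin> modified \<longrightarrow> s' x = s x))"
    proof (rule runs_Seq[where D' = "n * (n * 100 + 150) + 60"])
      show "runs (add_all (Get ''y'' (Var ''k'')) (Get ''y'' (Plus (Const M) (Var ''k''))) (Const M))
        (s(''m'' := (s ''m'')(aval (Const 0) s := aval (Const 0) s)))
        (M * (n * 100 + 120) + 9) (\<lambda>t. work t = foldl (add_free A) [] ys \<and> ?fr t)"
        using first unfolding s1_def by simp
      show "runs (Seq (add_all (Get ''row'' (Var ''k'')) (Get ''col'' (Var ''k'')) (Var ''size''))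
         (Cond (Less (Var ''size'') (Var ''m'')) copy_work Skip)) t (n * (n * 100 + 150) + 60)
        (\<lambda>s'. result s' = improve A ys (result s) \<and> (\<forall>x. x \<notin> modified \<longrightarrow> s' x = s x))"
        if "work t = foldl (add_free A) [] ys \<and> ?fr t" for t
        by (rule runs_Seq[OF second[OF that] third]) (auto simp: algebra_simps)
    qed simp
  qed simp
  then show ?thesis unfolding ys_def .
qed

section \<open>Enumerating all tuples\<close>

text \<open>Cell \<open>k\<close> of \<open>y\<close> is the counter of loop \<open>k\<close>; the
  outermost loop runs over the highest digit.\<close>

primrec nest :: "nat \<Rightarrow> com \<Rightarrow> com" where
  "nest 0 c = c"
| "nest (Suc k) c = for_loop ''y'' k (Var ''n'') (nest k c)"

primrec nest_time :: "nat \<Rightarrow> nat \<Rightarrow> nat \<Rightarrow> nat" where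
  "nest_time n B 0 = B"
| "nest_time n B (Suc k) = n * (nest_time n B k + 13) + 10"

definition step_time :: "nat \<Rightarrow> nat \<Rightarrow> nat" where
  "step_time M n = M * (n * 100 + 120) + n * (n * 100 + 150) + 100"

definition improvable :: "(nat \<Rightarrow> nat \<Rightarrow> 'a) \<Rightarrow> nat \<Rightarrow> (nat \<times> nat) list \<Rightarrow> (nat \<Rightarrow> nat) \<Rightarrow> bool" where
  "improvable A M ts d \<longleftrightarrow> length ts < length (greedy A (tuple M d) ts)"

lemma improvable_cong:
  assumes "\<And>j. j < 2 * M \<Longrightarrow> d j = d' j"
  shows "improvable A M ts d = improvable A M ts d'"
proof -
  have "tuple M d = tuple M d'" unfolding tuple_def using assms by simp
  then show ?thesis unfolding improvable_def by simp
qed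

lemma env_upd_y [simp]: "env n A (s(''y'' := h)) = env n A s"
  unfolding env_def by simp

lemma env_upd_q [simp]: "env n A (s(''q'' := h)) = env n A s"
  unfolding env_def by simp

lemma result_upd_y [simp]: "result (s(''y'' := h)) = result s"
  unfolding result_def by simp

lemma result_upd_q [simp]: "result (s(''q'' := h)) = result s"
  unfolding result_def by simp

text \<open>The transversal may change midway, so optimality is claimed only if the pass gained
  nothing: then it was the same throughout, and every tuple with the given upper digits was tried on
  it.\<close>

lemma runs_nest:
  assumes "env n A s" "valid n A (result s)" "k \<le> 2 * M"
    "\<And>j. k \<le> j \<Longrightarrow> j < 2 * M \<Longrightarrow> s ''y'' j < n"
  shows "runs (nest k (improve_step M)) s (nest_time n (step_time M n) k)
    (\<lambda>s'. env n A s' \<and> valid n A (result s') \<and> s' ''q'' = s ''q'' \<and>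
      (\<forall>j\<ge>k. s' ''y'' j = s ''y'' j) \<and>
      (length (result s) < length (result s') \<or> result s' = result s \<and>
        (\<forall>d. (\<forall>j<k. d j < n) \<longrightarrow> (\<forall>j\<ge>k. d j = s ''y'' j) \<longrightarrow> \<not> improvable A M (result s) d)))"
  using assms
proof (induction k arbitrary: s)
  case 0
  have y: "s ''y'' j < n" if "j < 2 * M" for j using 0(4) that by simp
  have "runs (improve_step M) s (step_time M n)
    (\<lambda>s'. result s' = improve A (tuple M (s ''y'')) (result s) \<and> (\<forall>x. x \<notin> modified \<longrightarrow> s' x = s x))"
    unfolding step_time_def by (rule runs_improve_step[OF 0(1,2) y])
  then show ?case
    unfolding nest.simps nest_time.simps
  proof (rule runs_weaken[OF _ order_refl], goal_cases)
    case (1 s')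
    then have fr: "s' x = s x" if "x \<notin> modified" for x using that by blast
    have names: "''n'' \<notin> modified" "''A'' \<notin> modified" "''off'' \<notin> modified" "''q'' \<notin> modified" "''y'' \<notin> modified"
      unfolding modified_def scratch_def by simp_all
    have e: "env n A s'" using 0(1) fr[OF names(1)] fr[OF names(2)] fr[OF names(3)] unfolding env_def by simp
    have v: "valid n A (result s')"
      using 1 0(2) valid_greedy[OF 0(2) set_tuple[OF y]] unfolding improve_def by simp
    have "d = s ''y''" if "\<forall>j\<ge>0. d j = s ''y'' j" for d using that by auto
    then have opt: "length (result s) < length (result s') \<or> result s' = result s \<and>
        (\<forall>d. (\<forall>j<0. d j < n) \<longrightarrow> (\<forall>j\<ge>0. d j = s ''y'' j) \<longrightarrow> \<not> improvable A M (result s) d)"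
      using 1 unfolding improve_def improvable_def by auto
    have "\<forall>j\<ge>0. s' ''y'' j = s ''y'' j" using fr[OF names(5)] by simp
    with e v fr[OF names(4)] opt show ?case by (intro conjI)
  qed
next
  case (Suc k)
  define I where "I a t \<longleftrightarrow> env n A t \<and> valid n A (result t) \<and> t ''q'' = s ''q'' \<and>
    (\<forall>j\<ge>Suc k. t ''y'' j = s ''y'' j) \<and>
    (length (result s) < length (result t) \<or> result t = result s \<and>
      (\<forall>d. (\<forall>j<k. d j < n) \<longrightarrow> d k < a \<longrightarrow> (\<forall>j\<ge>Suc k. d j = s ''y'' j) \<longrightarrow>
        \<not> improvable A M (result s) d))" for a t
  have "runs (for_loop ''y'' k (Var ''n'') (nest k (improve_step M))) s
      (n * (nest_time n (step_time M n) k + 13) + 10) (I n)"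
  proof (rule runs_for)
    show "I 0 (s(''y'' := (s ''y'')(k := 0)))" using Suc.prems(1,2) unfolding I_def by simp
    show "aval (Var ''n'') t = n" if "I a t" for a t using that unfolding I_def env_def by simp
    show "n * (nest_time n (step_time M n) k + acost (Var ''n'') + 11) + acost (Var ''n'') + 8
        \<le> n * (nest_time n (step_time M n) k + 13) + 10"
      by simp
    fix a t assume a: "a < n" and ta: "t ''y'' k = a" and I: "I a t"
    have t: "env n A t" "valid n A (result t)" "t ''q'' = s ''q''"
      and ty: "\<And>j. Suc k \<le> j \<Longrightarrow> t ''y'' j = s ''y'' j"
      and res: "length (result s) < length (result t) \<or> result t = result s \<and>
        (\<forall>d. (\<forall>j<k. d j < n) \<longrightarrow> d k < a \<longrightarrow> (\<forall>j\<ge>Suc k. d j = s ''y'' j) \<longrightarrow>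
          \<not> improvable A M (result s) d)"
      using I unfolding I_def by simp_all
    have digits: "t ''y'' j < n" if "k \<le> j" "j < 2 * M" for j
    proof (cases "j = k")
      case True
      then show ?thesis using ta a by simp
    next
      case False
      then show ?thesis using that ty[of j] Suc.prems(4)[of j] by simp
    qed
    have k: "k \<le> 2 * M" using Suc.prems(3) by simp
    show "runs (nest k (improve_step M)) t (nest_time n (step_time M n) k)
        (\<lambda>t'. t' ''y'' k = a \<and> I (Suc a) (t'(''y'' := (t' ''y'')(k := Suc a))))"
    proof (rule runs_weaken[OF Suc.IH[OF t(1,2) k] order_refl], goal_cases)
      case (1 j)
      then show ?case by (rule digits)
    next
      case (2 t')
      then have t': "env n A t'" "valid n A (result t')" "t' ''q'' = t ''q''"
        and ty': "\<And>j. k \<le> j \<Longrightarrow> t' ''y'' j = t ''y'' j"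
        and res': "length (result t) < length (result t') \<or> result t' = result t \<and>
          (\<forall>d. (\<forall>j<k. d j < n) \<longrightarrow> (\<forall>j\<ge>k. d j = t ''y'' j) \<longrightarrow> \<not> improvable A M (result t) d)"
        by simp_all
      have "length (result s) < length (result t') \<or> result t' = result s \<and>
        (\<forall>d. (\<forall>j<k. d j < n) \<longrightarrow> d k < Suc a \<longrightarrow> (\<forall>j\<ge>Suc k. d j = s ''y'' j) \<longrightarrow>
          \<not> improvable A M (result s) d)"
      proof (cases "length (result s) < length (result t')")
        case False
        \<comment> \<open>Lengths never decrease, so no gain at the end means no gain
          before.\<close>
        then have eq: "result t = result s" "result t' = result s"
          using res res' by auto
        have "\<not> improvable A M (result s) d"
          if d: "\<forall>j<k. d j < n" "d k < Suc a" "\<forall>j\<ge>Suc k. d j = s ''y'' j" for d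
        proof (cases "d k < a")
          case True
          then show ?thesis using res d eq by auto
        next
          case False
          then have "d k = a" using d(2) by simp
          then have "d j = t ''y'' j" if "k \<le> j" for j
            using that ty[of j] d(3) ta by (cases "j = k") auto
          then show ?thesis using res' d(1) eq by auto
        qed
        then show ?thesis using eq by blast
      qed simp
      then show ?case
        using t' ty ty' ta t(3) unfolding I_def by simp
    qed
  qed
  then show ?case
    unfolding nest.simps nest_time.simps
  proof (rule runs_weaken[OF _ order_refl], goal_cases)
    case (1 t)
    then have t: "env n A t" "valid n A (result t)" "t ''q'' = s ''q''"
        "\<forall>j\<ge>Suc k. t ''y'' j = s ''y'' j"
      and res: "length (result s) < length (result t) \<or> result t = result s \<and>
        (\<forall>d. (\<forall>j<k. d j < n) \<longrightarrow> d k < n \<longrightarrow> (\<forall>j\<ge>Suc k. d j = s ''y'' j) \<longrightarrow>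
          \<not> improvable A M (result s) d)"
      unfolding I_def by simp_all
    have "length (result s) < length (result t) \<or> result t = result s \<and>
        (\<forall>d. (\<forall>j<Suc k. d j < n) \<longrightarrow> (\<forall>j\<ge>Suc k. d j = s ''y'' j) \<longrightarrow>
          \<not> improvable A M (result s) d)"
      using res unfolding All_less_Suc by blast
    with t show ?case by (intro conjI)
  qed
qed

text \<open>Tabulates \<open>i * n\<close>, since the machine cannot multiply.\<close>

definition offsets :: com where
  "offsets = for_loop ''k'' 0 (Var ''n'')
     (Put ''off'' (Plus (Var ''k'') (Const 1)) (Plus (Get ''off'' (Var ''k'')) (Var ''n'')))"

text \<open>The table starts correctly because cells outside the input are 0. Index
  \<open>i * n + j\<close> then lies below \<open>n * n\<close>, where the input holds the
  square.\<close>

lemma runs_offsets: "runs offsets (input n A) (n * 24 + 10) (\<lambda>t. env n A t \<and> result t = [])"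
proof -
  define s where "s = input n A"
  define I where "I k t \<longleftrightarrow> (\<forall>i\<le>k. t ''off'' i = i * n) \<and>
    (\<forall>x. x \<notin> {''k'', ''off''} \<longrightarrow> t x = s x)" for k t
  have n: "s ''n'' 0 = n" "s ''off'' 0 = 0" unfolding s_def input_def by simp_all
  have "runs offsets s (n * 24 + 10) (I n)"
    unfolding offsets_def
  proof (rule runs_for[where B = 11])
    show "I 0 (s(''k'' := (s ''k'')(0 := 0)))" using n unfolding I_def by simp
    show "aval (Var ''n'') t = n" if "I k t" for k t using that n unfolding I_def by simp
    fix k t assume tk: "t ''k'' 0 = k" and I: "I k t"
    have "t ''n'' 0 = n" using I n unfolding I_def by simp
    then show "runs (Put ''off'' (Plus (Var ''k'') (Const 1)) (Plus (Get ''off'' (Var ''k'')) (Var ''n'')))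
        t 11 (\<lambda>t'. t' ''k'' 0 = k \<and> I (Suc k) (t'(''k'' := (t' ''k'')(0 := Suc k))))"
      using I tk unfolding I_def by (intro runs_Put) (auto simp: le_Suc_eq)
  qed simp
  then show ?thesis
    unfolding s_def[symmetric]
  proof (rule runs_weaken[OF _ order_refl])
    fix t assume I: "I n t"
    have "i * n + j < n * n" if "i < n" "j < n" for i j
    proof -
      have "i * n + j < Suc i * n" using that by simp
      also have "\<dots> \<le> n * n" using that by (intro mult_le_mono1) simp
      finally show ?thesis .
    qed
    then have "env n A t"
      using I n unfolding I_def env_def s_def by (simp add: input_def)
    moreover have "t ''size'' 0 = 0" using I unfolding I_def s_def by (simp add: input_def)
    ultimately show "env n A t \<and> result t = []" unfolding result_def by simp
  qed
qed

section \<open>The complete search\<close>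

text \<open>A transversal has at most \<open>n\<close> entries, so \<open>n\<close> rounds suffice;
  fixing their number in advance makes termination independent of the square.\<close>

definition search :: "nat \<Rightarrow> com" where
  "search M = Seq offsets (for_loop ''q'' 0 (Var ''n'') (nest (2 * M) (improve_step M)))"

definition search_time :: "nat \<Rightarrow> nat \<Rightarrow> nat" where
  "search_time M n = n * (nest_time n (step_time M n) (2 * M) + 13) + 10 + (n * 24 + 10) + 1"

text \<open>After \<open>a\<close> rounds the length is at least \<open>min a m\<close>: a round
  without gain certifies that no tuple improves, which \<open>imp\<close> excludes below
  \<open>m\<close>.\<close>

lemma runs_search:
  assumes imp: "\<And>ts. valid n A ts \<Longrightarrow> length ts < m \<Longrightarrow>
      \<exists>d. (\<forall>j<2 * M. d j < n) \<and> improvable A M ts d"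
    and m: "m \<le> n"
  shows "runs (search M) (input n A) (search_time M n) (\<lambda>t. valid n A (result t) \<and> m \<le> length (result t))"
proof -
  define I where "I a t \<longleftrightarrow> env n A t \<and> valid n A (result t) \<and> min a m \<le> length (result t)" for a t
  have loop: "runs (for_loop ''q'' 0 (Var ''n'') (nest (2 * M) (improve_step M))) s
      (n * (nest_time n (step_time M n) (2 * M) + 13) + 10) (I n)"
    if s: "env n A s \<and> result s = []" for s
  proof (rule runs_for)
    show "I 0 (s(''q'' := (s ''q'')(0 := 0)))" using s valid_Nil unfolding I_def by simp
    show "aval (Var ''n'') t = n" if "I a t" for a t using that unfolding I_def env_def by simp
    show "n * (nest_time n (step_time M n) (2 * M) + acost (Var ''n'') + 11) + acost (Var ''n'') + 8
        \<le> n * (nest_time n (step_time M n) (2 * M) + 13) + 10"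
      by simp
    fix a t assume ta: "t ''q'' 0 = a" and I: "I a t"
    then have t: "env n A t" "valid n A (result t)" "min a m \<le> length (result t)"
      unfolding I_def by simp_all
    have "runs (nest (2 * M) (improve_step M)) t (nest_time n (step_time M n) (2 * M))
      (\<lambda>s'. env n A s' \<and> valid n A (result s') \<and> s' ''q'' = t ''q'' \<and>
      (\<forall>j\<ge>2 * M. s' ''y'' j = t ''y'' j) \<and>
      (length (result t) < length (result s') \<or> result s' = result t \<and>
        (\<forall>d. (\<forall>j<2 * M. d j < n) \<longrightarrow> (\<forall>j\<ge>2 * M. d j = t ''y'' j) \<longrightarrow> \<not> improvable A M (result t) d)))"
      by (rule runs_nest[OF t(1,2)]) auto
    then show "runs (nest (2 * M) (improve_step M)) t (nest_time n (step_time M n) (2 * M))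
        (\<lambda>t'. t' ''q'' 0 = a \<and> I (Suc a) (t'(''q'' := (t' ''q'')(0 := Suc a))))"
    proof (rule runs_weaken[OF _ order_refl], goal_cases)
      case (1 t')
      have "min (Suc a) m \<le> length (result t')"
      proof (cases "length (result t) < length (result t')")
        case True
        then show ?thesis using t(3) by simp
      next
        case False
        then have eq: "result t' = result t" and opt: "\<And>d. \<forall>j<2 * M. d j < n \<Longrightarrow>
            \<forall>j\<ge>2 * M. d j = t ''y'' j \<Longrightarrow> \<not> improvable A M (result t) d"
          using 1 by auto
        have "m \<le> length (result t)"
        proof (rule ccontr)
          assume "\<not> m \<le> length (result t)"
          then obtain d where d: "\<forall>j<2 * M. d j < n" "improvable A M (result t) d"
            using imp[OF t(2)] by auto
          \<comment> \<open>\<open>runs_nest\<close> speaks of digits that agree with the memory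
            from \<open>2 * M\<close> on; those digits do not affect the tuple.\<close>
          define d' where "d' j = (if j < 2 * M then d j else t ''y'' j)" for j
          have "improvable A M (result t) d' = improvable A M (result t) d"
            by (rule improvable_cong) (simp add: d'_def)
          then show False using opt[of d'] d by (simp add: d'_def)
        qed
        then show ?thesis using eq by simp
      qed
      then show ?case using 1 ta unfolding I_def by simp
    qed
  qed
  have "runs (search M) (input n A) (search_time M n) (I n)"
    unfolding search_def by (rule runs_Seq[OF runs_offsets loop]) (auto simp: search_time_def)
  then show ?thesis
    by (rule runs_weaken[OF _ order_refl]) (simp add: I_def min_absorb2[OF m])
qed

section \<open>Polynomial time bounds\<close>

definition polynomial :: "(nat \<Rightarrow> nat) \<Rightarrow> bool" where
  "polynomial f \<longleftrightarrow> (\<exists>p :: nat poly. \<forall>n. f n = poly p n)"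

lemma polynomial_const: "polynomial (\<lambda>n. c)"
  unfolding polynomial_def by (intro exI[of _ "[:c:]"]) simp

lemma polynomial_ident: "polynomial (\<lambda>n. n)"
  unfolding polynomial_def by (intro exI[of _ "[:0, 1:]"]) simp

lemma polynomial_add: "polynomial f \<Longrightarrow> polynomial g \<Longrightarrow> polynomial (\<lambda>n. f n + g n)"
  unfolding polynomial_def by (metis poly_add)

lemma polynomial_mult: "polynomial f \<Longrightarrow> polynomial g \<Longrightarrow> polynomial (\<lambda>n. f n * g n)"
  unfolding polynomial_def by (metis poly_mult)

lemmas polynomial_intros = polynomial_const polynomial_ident polynomial_add polynomial_mult

text \<open>The depth \<open>k\<close> is constant, and each level multiplies the time by
  \<open>n\<close> up to lower terms.\<close>

lemma polynomial_nest_time: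
  "polynomial f \<Longrightarrow> polynomial (\<lambda>n. nest_time n (f n) k)"
  by (induction k) (simp_all add: polynomial_intros)

lemma polynomial_search_time: "polynomial (search_time M)"
  unfolding search_time_def step_time_def
  by (intro polynomial_intros polynomial_nest_time)

lemma polynomial_time_search: "polynomial_time (search M)"
proof -
  obtain p where p: "\<And>n. search_time M n = poly p n"
    using polynomial_search_time unfolding polynomial_def by blast
  have "\<exists>t s. exec (search M) (input n A) t s \<and> t \<le> poly p n" for n A
    \<comment> \<open>With target length 0 the improvability hypothesis is vacuous, so the time
      bound covers every square.\<close>
    using runs_search[of n A 0 M] unfolding runs_def p by auto
  then show ?thesis unfolding polynomial_time_def by blast
qed

theorem theorem1p4:
  fixes \<epsilon> \<beta> :: real
  assumes "\<epsilon> > 0" and "0 < \<beta>" and "\<beta> < 1"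
  shows "\<exists>(n0 :: nat) (c :: com). polynomial_time c \<and>
    (\<forall>n A. n \<ge> n0 \<longrightarrow> bounded_square \<beta> n A \<longrightarrow>
       finds_transversal c n A ((1 - \<beta> / 4 - \<epsilon>) * real n))"
proof -
  obtain M n0 where opt: "\<forall>n (A :: nat \<Rightarrow> nat \<Rightarrow> nat) T. n0 \<le> n \<longrightarrow> bounded_square \<beta> n A \<longrightarrow>
    transversal n A T \<longrightarrow>
    (\<forall>U. transversal n A U \<longrightarrow> card (U - T) \<le> M \<longrightarrow> card U \<le> card T) \<longrightarrow>
    (1 - \<beta> / 4 - \<epsilon>) * n \<le> card T"
    using local_optimum_large[OF assms, where 'a = nat] by (elim exE)
  have "finds_transversal (search M) n A ((1 - \<beta> / 4 - \<epsilon>) * real n)"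
    if n: "n0 \<le> n" and sq: "bounded_square \<beta> n A" for n A
  proof -
    define x where "x = (1 - \<beta> / 4 - \<epsilon>) * real n"
    \<comment> \<open>Rounding up loses nothing: a natural number is below \<open>m\<close> exactly
      if it is below \<open>x\<close>. A negative \<open>x\<close> gives
      \<open>m = 0\<close>.\<close>
    define m where "m = nat \<lceil>x\<rceil>"
    have "x \<le> 1 * real n" unfolding x_def using assms by (intro mult_right_mono) auto
    then have m: "m \<le> n" unfolding m_def by linarith
    have "\<exists>d. (\<forall>j<2 * M. d j < n) \<and> improvable A M ts d"
      if ts: "valid n A ts" and len: "length ts < m" for ts
    proof -
      have tr: "transversal n A (set ts)" "card (set ts) = length ts"
        using ts distinct_card unfolding valid_def by auto
      \<comment> \<open>Too short a list is not locally optimal, and a better transversal with at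
        most \<open>M\<close> new entries yields an improving tuple.\<close>
      have "real (card (set ts)) < x" using len tr(2) unfolding m_def by linarith
      then obtain U where "transversal n A U" "card (U - set ts) \<le> M" "card (set ts) < card U"
        using opt n sq tr(1) unfolding x_def by (meson not_le)
      then obtain d where "\<And>j. j < 2 * M \<Longrightarrow> d j < n" "length ts < length (greedy A (tuple M d) ts)"
        using improving_tuple[OF ts] by blast
      then show ?thesis unfolding improvable_def by blast
    qed
    from runs_search[OF this m] obtain t s where s: "exec (search M) (input n A) t s"
      "valid n A (result s)" "m \<le> length (result s)"
      unfolding runs_def by blast
    have "card (set (result s)) = length (result s)" using s(2) distinct_card unfolding valid_def by blast
    then have "x \<le> card (set (result s))" using s(3) unfolding m_def by linarith
    then show ?thesis using s(1,2) unfolding finds_transversal_def valid_def x_def by blast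
  qed
  then show ?thesis using polynomial_time_search by blast
qed

end
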